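(* Let $G$ be a connected graph which is a complete intersection. Then: - if $G$ is bipartite, $2|E(G)|+4\le 4|V(G)|-\sum_{v\in V(G)}b(G\setminus\{v\})$; - if $G$ is not bipartite, $2|E(G)|\le 3|V(G)|-\sum_{v\in V(G)}b(G\setminus\{v\})$. In both cases equality is attained if and only if $P_G$ is generated by quadrics.
   Context: Graphs are finite, simple (no loops, no multiple edges) and undirected. Let $k$ be an arbitrary field. For a graph $G$ with $V(G)=\{v_1,\ldots,v_m\}$ and $E(G)=\{e_1,\ldots,e_n\}$, the toric ideal $P_G$ of $G$ is the kernel of the $k$-algebra homomorphism $k[x_1,\ldots,x_n]\to k[t_1,\ldots,t_m]$ with $x_i\mapsto t_jt_l$ whenever $e_i=\{v_j,v_l\}$. $G$ is a complete intersection if $\mu(P_G)=\mathrm{ht}(P_G)$, where $\mu(P_G)$ is the minimal number of generators of $P_G$ (if $P_G=0$ both numbers are $0$). $G\setminus\{v\}$ denotes the induced subgraph on $V(G)\setminus\{v\}$. $b(H)$ is the number of connected components of $H$ that are bipartite (an isolated vertex is a bipartite component; $b$ of the empty graph is $0$). A quadric is a polynomial in $k[x_1,\ldots,x_n]$ that is homogeneous of degree $2$ in the variables $x_i$; the zero ideal is considered generated by quadrics (empty generating set). *)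

theory Defs
  imports "HOL-Algebra.RingHom" "HOL-Library.Poly_Mapping" "HOL-Library.Extended_Nat"
begin

section \<open>Finite simple graphs\<close>

definition simple_graph :: "'v set \<Rightarrow> 'v set set \<Rightarrow> bool" where
  "simple_graph V E \<longleftrightarrow> finite V \<and> (\<forall>e\<in>E. e \<subseteq> V \<and> card e = 2)"

definition induced_edges :: "'v set set \<Rightarrow> 'v set \<Rightarrow> 'v set set" where
  "induced_edges E W = {e \<in> E. e \<subseteq> W}"

definition joined :: "'v set \<Rightarrow> 'v set set \<Rightarrow> ('v \<times> 'v) set" where
  "joined V E = {(u, v). u \<in> V \<and> v \<in> V \<and> (u, v) \<in> {(x, y). {x, y} \<in> E}\<^sup>*}"

text \<open>The empty graph is not connected.\<close>
definition connected_graph :: "'v set \<Rightarrow> 'v set set \<Rightarrow> bool" where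
  "connected_graph V E \<longleftrightarrow> V \<noteq> {} \<and> (\<forall>u\<in>V. \<forall>v\<in>V. (u, v) \<in> joined V E)"

definition components :: "'v set \<Rightarrow> 'v set set \<Rightarrow> 'v set set" where
  "components V E = V // joined V E"

definition bipartite_graph :: "'v set \<Rightarrow> 'v set set \<Rightarrow> bool" where
  "bipartite_graph V E \<longleftrightarrow>
     (\<exists>A B. A \<union> B = V \<and> A \<inter> B = {} \<and> (\<forall>e\<in>E. \<exists>a\<in>A. \<exists>b\<in>B. e = {a, b}))"

definition num_bipartite_components :: "'v set \<Rightarrow> 'v set set \<Rightarrow> nat" where
  "num_bipartite_components V E =
     card {C \<in> components V E. bipartite_graph C (induced_edges E C)}"

section \<open>Polynomial rings\<close>

text \<open>A polynomial maps each monomial (an exponent vector \<open>'x \<Rightarrow>\<^sub>0 nat\<close>) to its coefficient;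
  \<open>poly_ring X\<close> is the ring of those polynomials in which only variables from \<open>X\<close> occur.\<close>

type_synonym ('x, 'k) mpoly = "('x \<Rightarrow>\<^sub>0 nat) \<Rightarrow>\<^sub>0 'k"

definition indets :: "('x, 'k::zero) mpoly \<Rightarrow> 'x set" where
  "indets p = (\<Union>m\<in>Poly_Mapping.keys p. Poly_Mapping.keys m)"

definition poly_ring :: "'x set \<Rightarrow> ('x, 'k::field) mpoly ring" where
  "poly_ring X = \<lparr>carrier = {p. indets p \<subseteq> X}, mult = (*), one = 1, zero = 0, add = (+)\<rparr>"

definition const :: "'k::field \<Rightarrow> ('x, 'k) mpoly" where
  "const c = Poly_Mapping.single 0 c"

definition var :: "'x \<Rightarrow> ('x, 'k::field) mpoly" where
  "var x = Poly_Mapping.single (Poly_Mapping.single x 1) 1"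

text \<open>The algebra homomorphism sending each variable \<open>x\<close> to \<open>f x\<close>.\<close>
definition poly_subst :: "('x \<Rightarrow> ('y, 'k) mpoly) \<Rightarrow> ('x, 'k::field) mpoly \<Rightarrow> ('y, 'k) mpoly" where
  "poly_subst f p = (\<Sum>m\<in>Poly_Mapping.keys p. const (Poly_Mapping.lookup p m) *
     (\<Prod>x\<in>Poly_Mapping.keys m. f x ^ Poly_Mapping.lookup m x))"

definition homogeneous :: "nat \<Rightarrow> ('x, 'k::zero) mpoly \<Rightarrow> bool" where
  "homogeneous d p \<longleftrightarrow>
     (\<forall>m\<in>Poly_Mapping.keys p. (\<Sum>x\<in>Poly_Mapping.keys m. Poly_Mapping.lookup m x) = d)"

lemma indets_add: "indets (p + q) \<subseteq> indets p \<union> indets q"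
  using Poly_Mapping.keys_add[of p q] by (auto simp: indets_def)

lemma indets_uminus: "indets (- p :: ('x, 'k::field) mpoly) = indets p"
  by (simp add: indets_def)

lemma indets_mult: "indets (p * q :: ('x, 'k::field) mpoly) \<subseteq> indets p \<union> indets q"
proof
  fix x assume "x \<in> indets (p * q)"
  then obtain m where m: "m \<in> Poly_Mapping.keys (p * q)" "x \<in> Poly_Mapping.keys m"
    by (auto simp: indets_def)
  from m(1) obtain a b where ab: "m = a + b" "a \<in> Poly_Mapping.keys p" "b \<in> Poly_Mapping.keys q"
    using Poly_Mapping.keys_mult[of p q] by blast
  with m(2) have "x \<in> Poly_Mapping.keys a \<union> Poly_Mapping.keys b"
    using Poly_Mapping.keys_add[of a b] by blast
  with ab show "x \<in> indets p \<union> indets q"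
    by (auto simp: indets_def)
qed

lemma indets_zero: "indets 0 = {}" and indets_one: "indets (1 :: ('x, 'k::field) mpoly) = {}"
  by (simp_all add: indets_def flip: single_one)

lemma poly_ring_cring: "cring (poly_ring X :: ('x, 'k::field) mpoly ring)"
proof (intro cringI abelian_groupI comm_monoidI)
  fix p :: "('x, 'k) mpoly"
  assume "p \<in> carrier (poly_ring X)"
  then show "\<exists>q\<in>carrier (poly_ring X). q \<oplus>\<^bsub>poly_ring X\<^esub> p = \<zero>\<^bsub>poly_ring X\<^esub>"
    by (intro bexI[of _ "- p"]) (auto simp: poly_ring_def indets_uminus)
next
  fix p q :: "('x, 'k) mpoly"
  assume "p \<in> carrier (poly_ring X)" "q \<in> carrier (poly_ring X)"
  then show "p \<oplus>\<^bsub>poly_ring X\<^esub> q \<in> carrier (poly_ring X)"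
    and "p \<otimes>\<^bsub>poly_ring X\<^esub> q \<in> carrier (poly_ring X)"
    using indets_add[of p q] indets_mult[of p q] by (auto simp: poly_ring_def)
qed (simp_all add: poly_ring_def indets_zero indets_one algebra_simps)

section \<open>Number of generators and height of an ideal\<close>

definition min_generators :: "('a, 'b) ring_scheme \<Rightarrow> 'a set \<Rightarrow> enat" where
  "min_generators R I =
     Inf {enat (card S) | S. finite S \<and> S \<subseteq> carrier R \<and> genideal R S = I}"

text \<open>Supremum of the lengths \<open>n\<close> of chains \<open>C 0 \<subset> \<dots> \<subset> C n = P\<close> of prime ideals.\<close>
definition prime_height :: "('a, 'b) ring_scheme \<Rightarrow> 'a set \<Rightarrow> enat" where
  "prime_height R P =
     Sup {enat n | n. \<exists>C. (\<forall>i\<le>n. primeideal (C i) R) \<and> (\<forall>i<n. C i \<subset> C (Suc i)) \<and> C n = P}"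

definition ideal_height :: "('a, 'b) ring_scheme \<Rightarrow> 'a set \<Rightarrow> enat" where
  "ideal_height R I = Inf {prime_height R P | P. primeideal P R \<and> I \<subseteq> P}"

section \<open>Toric ideals of graphs\<close>

text \<open>The variables of the source are indexed by the edges themselves, those of the target by
  the vertices. For an edge \<open>e = {u, v}\<close> the product below is \<open>var u * var v\<close>.\<close>
definition toric_ideal :: "'v set \<Rightarrow> 'v set set \<Rightarrow> ('v set, 'k::field) mpoly set" where
  "toric_ideal V E = a_kernel (poly_ring E) (poly_ring V) (poly_subst (\<lambda>e. \<Prod>v\<in>e. var v))"

definition complete_intersection :: "'k::field itself \<Rightarrow> 'v set \<Rightarrow> 'v set set \<Rightarrow> bool" where
  "complete_intersection k V E \<longleftrightarrow>
     min_generators (poly_ring E) (toric_ideal V E :: ('v set, 'k) mpoly set) =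
     ideal_height (poly_ring E) (toric_ideal V E :: ('v set, 'k) mpoly set)"

definition toric_generated_by_quadrics :: "'k::field itself \<Rightarrow> 'v set \<Rightarrow> 'v set set \<Rightarrow> bool" where
  "toric_generated_by_quadrics k V E \<longleftrightarrow>
     (\<exists>Q. Q \<subseteq> {q \<in> carrier (poly_ring E). homogeneous 2 q} \<and>
        (toric_ideal V E :: ('v set, 'k) mpoly set) = genideal (poly_ring E) Q)"

end

theory Submission
  imports Defs "HOL-Library.Function_Algebras"
begin

text \<open>
  Write \<open>n = |E|\<close>, \<open>m = |V|\<close> and, for a graph \<open>H\<close>, let \<open>h(H) = |E(H)| - |V(H)| + b(H)\<close>. This is the
  dimension of the rational cycle space of \<open>H\<close>, that is, of the relations between the columns of its
  vertex-edge incidence matrix, because the rank of that matrix is \<open>|V(H)| - b(H)\<close>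
  (\<open>incidence_basis\<close>). Everything follows from a count of the generators of the toric ideal that
  involve a given vertex.

  The toric ideal \<open>T\<close> consists of the polynomials whose coefficients sum to zero over
  every set of monomials of equal vertex degree, so it is spanned by the binomials \<open>x^a - x^b\<close> with \<open>deg a = deg b\<close>. For an arbitrary graph the height of
  \<open>T\<close> is at most \<open>h\<close> (\<open>toric_height_le\<close>): an edge set on which the incidence matrix has independent
  columns gives variables that are algebraically independent modulo \<open>T\<close>, every strict inclusion in a
  chain of primes below \<open>T\<close> contributes one more algebraically independent element, and \<open>n\<close> variables
  leave room for only \<open>n\<close> of these. If \<open>G\<close> is a complete intersection, \<open>T\<close> therefore has a
  generating set of at most \<open>h(G)\<close> elements.

  Choose a smallest set of pairs \<open>(a, b)\<close> whose binomials generate \<open>T\<close>. As in Nakayama's lemma, for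
  the grading by vertex degree, its syzygies have no constant terms (\<open>syzygy_constant_term\<close>), and so
  it has at most as many elements as any generating set (\<open>card_le_generators\<close>), hence at most \<open>h(G)\<close>.
  For \<open>W \<subseteq> V\<close>, selecting the terms whose degree is supported in \<open>W\<close> shows that the chosen binomials
  with degree supported in \<open>W\<close> generate the toric ideal of the induced subgraph. Their exponent
  differences \<open>a - b\<close> then span its cycle space (\<open>cycle_space_span\<close>). For \<open>W = V\<close> these are at most
  \<open>h(G)\<close> vectors spanning a space of dimension \<open>h(G)\<close>; so they are independent, and for every \<open>W\<close>
  exactly \<open>h(G[W])\<close> of the binomials are supported in \<open>W\<close> (\<open>card_supported\<close>).

  Applied to \<open>W = V\<close> and \<open>W = V - {v}\<close> this says that exactly \<open>b(G) - 1 + d(v) - b(G - v)\<close> of the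
  \<open>h(G)\<close> binomials involve \<open>v\<close>, where \<open>d(v)\<close> is the number of edges at \<open>v\<close>. Summing over
  \<open>v\<close>, the sizes of the supports of their degrees add up to
  \<open>m (b(G) - 1) + 2 n - (\<Sum>v. b(G - v))\<close>. Each support has at least four vertices, with equality
  exactly for quadrics (\<open>small_support\<close>), so this sum is at least \<open>4 h(G)\<close>; for \<open>b(G) = 1\<close> and
  \<open>b(G) = 0\<close> these are the two inequalities. Equality means that all chosen binomials are quadrics, which
  happens if and only if \<open>T\<close> is generated by quadrics (\<open>quadric_generators\<close>).
\<close>


section \<open>Linear algebra of functions\<close>

definition fscale :: "'k::field \<Rightarrow> ('a \<Rightarrow> 'k) \<Rightarrow> 'a \<Rightarrow> 'k" where
  "fscale c f = (\<lambda>x. c * f x)"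

interpretation fun_space: vector_space fscale
  by unfold_locales (auto simp: fscale_def algebra_simps fun_eq_iff)

lemma fscale_apply: "fscale c f x = c * f x"
  by (simp add: fscale_def)

lemma sum_fun_apply [simp]: "(\<Sum>i\<in>I. f i) x = (\<Sum>i\<in>I. f i x)"
  by (induction I rule: infinite_finite_induct) auto

definition unit_vec :: "'a \<Rightarrow> 'a \<Rightarrow> 'k::field" where
  "unit_vec a = (\<lambda>x. if x = a then 1 else 0)"

lemma inj_unit_vec: "inj (unit_vec :: 'a \<Rightarrow> 'a \<Rightarrow> 'k::field)"
  by (rule injI) (metis unit_vec_def one_neq_zero)

text \<open>The functions orthogonal to \<open>y\<close> form a subspace. This is the way to show that a vector lies outside a
  span.\<close>
lemma span_vanishing:
  fixes B :: "('a \<Rightarrow> 'k::field) set"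
  assumes "\<And>f. f \<in> B \<Longrightarrow> (\<Sum>v\<in>W. y v * f v) = 0" and "g \<in> fun_space.span B"
  shows "(\<Sum>v\<in>W. y v * g v) = 0"
proof -
  have "fun_space.span B \<subseteq> {f. (\<Sum>v\<in>W. y v * f v) = 0}"
    using assms(1)
    by (intro fun_space.span_minimal)
      (auto simp: fun_space.subspace_def fscale_apply algebra_simps sum.distrib simp flip: sum_distrib_left)
  then show ?thesis using assms(2) by auto
qed

lemma independent_unit_vecs: "fun_space.independent (unit_vec ` A :: ('a \<Rightarrow> 'k::field) set)"
  unfolding fun_space.dependent_def
proof safe
  fix a assume "(unit_vec a :: 'a \<Rightarrow> 'k) \<in> fun_space.span (unit_vec ` A - {unit_vec a})"
  then have "(\<Sum>v\<in>{a}. 1 * (unit_vec a v :: 'k)) = 0"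
    by (rule span_vanishing[rotated]) (auto simp: unit_vec_def)
  then show False by (simp add: unit_vec_def)
qed

lemma in_span_unit_vecs:
  assumes "finite J" "\<And>j. j \<notin> J \<Longrightarrow> f j = (0::'k::field)"
  shows "f \<in> fun_space.span (unit_vec ` J)"
proof -
  have "f = (\<Sum>j\<in>J. fscale (f j) (unit_vec j))"
    using assms by (auto simp: fun_eq_iff fscale_apply unit_vec_def if_distrib sum.delta cong: if_cong)
  moreover have "(\<Sum>j\<in>J. fscale (f j) (unit_vec j)) \<in> fun_space.span (unit_vec ` J)"
    by (intro fun_space.span_sum fun_space.span_scale fun_space.span_base) auto
  ultimately show ?thesis by simp
qed

text \<open>Independence is stated for the indexed family of rows, not for the set of rows; equal rows are then
  dependent, so that no injectivity has to be tracked when families of polynomials or of exponent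
  vectors are counted.\<close>
lemma independent_rows_le_columns:
  fixes M :: "'i \<Rightarrow> 'j \<Rightarrow> 'k::field"
  assumes "finite I" "finite J"
    and indep: "\<And>c. (\<And>j. j \<in> J \<Longrightarrow> (\<Sum>i\<in>I. c i * M i j) = 0) \<Longrightarrow> \<forall>i\<in>I. c i = 0"
  shows "card I \<le> card J"
proof -
  define N where "N i = (\<lambda>j. if j \<in> J then M i j else 0)" for i
  have inj: "inj_on N I"
  proof (rule inj_onI, rule ccontr)
    fix a b assume ab: "a \<in> I" "b \<in> I" "N a = N b" "a \<noteq> b"
    define c :: "'i \<Rightarrow> 'k" where "c = (\<lambda>i. (if i = a then 1 else 0) - (if i = b then 1 else 0))"
    have "(\<Sum>i\<in>I. c i * M i j) = 0" if "j \<in> J" for j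
    proof -
      have "M a j = M b j" using fun_cong[OF ab(3), of j] that by (simp add: N_def)
      moreover have "(\<Sum>i\<in>I. c i * M i j)
          = (\<Sum>i\<in>I. (if i = a then M i j else 0)) - (\<Sum>i\<in>I. (if i = b then M i j else 0))"
        unfolding sum_subtractf[symmetric] by (rule sum.cong) (auto simp: c_def)
      ultimately show ?thesis using ab assms(1) by (simp add: sum.delta)
    qed
    from indep[OF this] ab show False by (auto simp: c_def)
  qed
  have ind: "fun_space.independent (N ` I)"
  proof (rule fun_space.independent_if_scalars_zero)
    show "finite (N ` I)" using assms by simp
    fix f x assume s: "(\<Sum>x\<in>N ` I. fscale (f x) x) = 0" and x: "x \<in> N ` I"
    have s': "(\<Sum>i\<in>I. fscale (f (N i)) (N i)) = 0"
      using s by (subst (asm) sum.reindex[OF inj]) simp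
    have "(\<Sum>i\<in>I. f (N i) * M i j) = 0" if "j \<in> J" for j
      using fun_cong[OF s', of j] that by (simp add: N_def fscale_apply)
    from indep[OF this] x show "f x = 0" by auto
  qed
  have "N ` I \<subseteq> fun_space.span (unit_vec ` J)"
    by (auto simp: N_def intro!: in_span_unit_vecs[OF assms(2)])
  from fun_space.independent_span_bound[OF _ ind this]
  have "card (N ` I) \<le> card (unit_vec ` J :: ('j \<Rightarrow> 'k) set)" using assms by simp
  also have "\<dots> \<le> card J" using assms by (simp add: card_image_le)
  finally show ?thesis using inj by (simp add: card_image)
qed

text \<open>If the identity matrix indexed by \<open>I\<close> factors through \<open>S\<close>, then \<open>c = c A B\<close> for every row vector
  \<open>c\<close>, so the rows of \<open>A\<close> are independent.\<close>
lemma identity_factorization_le: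
  fixes a :: "'i \<Rightarrow> 's \<Rightarrow> 'k::field"
  assumes "finite I" "finite S"
    and "\<And>i j. i \<in> I \<Longrightarrow> j \<in> I \<Longrightarrow> (\<Sum>s\<in>S. a i s * b s j) = (if i = j then 1 else 0)"
  shows "card I \<le> card S"
proof (rule independent_rows_le_columns[OF assms(1,2), of a])
  fix c assume c: "\<And>s. s \<in> S \<Longrightarrow> (\<Sum>i\<in>I. c i * a i s) = 0"
  show "\<forall>i\<in>I. c i = 0"
  proof
    fix j assume j: "j \<in> I"
    have "c j = (\<Sum>i\<in>I. c i * (if i = j then 1 else 0))"
      using j assms(1) by (simp add: if_distrib sum.delta cong: if_cong)
    also have "\<dots> = (\<Sum>i\<in>I. c i * (\<Sum>s\<in>S. a i s * b s j))"
      using assms(3) j by (intro sum.cong) auto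
    also have "\<dots> = (\<Sum>s\<in>S. (\<Sum>i\<in>I. c i * a i s) * b s j)"
      unfolding sum_distrib_left sum_distrib_right by (subst sum.swap) (simp add: mult.assoc)
    also have "\<dots> = 0" using c by simp
    finally show "c j = 0" .
  qed
qed

section \<open>Rank of the incidence matrix and cycle space\<close>

lemma joined_equiv:
  "equiv W (joined W E)"
proof (rule equivI)
  show "joined W E \<subseteq> W \<times> W" by (auto simp: joined_def)
  show "refl_on W (joined W E)" by (auto simp: refl_on_def joined_def)
  have "sym {(x, y). {x, y} \<in> E}" by (auto simp: sym_def insert_commute)
  then have "sym ({(x, y). {x, y} \<in> E}\<^sup>*)" by (rule sym_rtrancl)
  then show "sym (joined W E)" by (auto simp: sym_def joined_def)
  show "trans (joined W E)" by (auto simp: trans_def joined_def)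
qed

lemma edge_obtain:
  assumes "simple_graph W E" "e \<in> E"
  obtains a b where "e = {a, b}" "a \<noteq> b" "a \<in> W" "b \<in> W"
proof -
  have "e \<subseteq> W" "card e = 2" using assms by (auto simp: simple_graph_def)
  then show ?thesis using that by (auto simp: card_2_iff)
qed

lemma finite_edges:
  assumes "simple_graph W E" shows "finite E"
proof -
  have "E \<subseteq> Pow W" "finite (Pow W)" using assms by (auto simp: simple_graph_def)
  then show ?thesis by (rule finite_subset)
qed

text \<open>Column \<open>e\<close> of the vertex-edge incidence matrix. It is taken over the rationals whatever the field \<open>k\<close>
  is: the rank of the matrix drops in characteristic two.\<close>
definition incidence :: "'v set \<Rightarrow> 'v \<Rightarrow> rat" where
  "incidence e = (\<lambda>v. if v \<in> e then 1 else 0)"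

lemma incidence_edge: "a \<noteq> b \<Longrightarrow> incidence {a, b} = unit_vec a + unit_vec b"
  by (auto simp: fun_eq_iff incidence_def unit_vec_def)

lemma inj_incidence: "inj incidence"
  by (rule injI) (auto simp: fun_eq_iff incidence_def split: if_splits)

lemma component_closed:
  assumes "simple_graph W E" "C \<in> components W E" "{a, b} \<in> E" "a \<in> C"
  shows "b \<in> C"
proof -
  have "a \<in> W" "b \<in> W" using assms(1,3) by (auto simp: simple_graph_def)
  then have "(a, b) \<in> joined W E" using assms(3) by (auto simp: joined_def)
  with assms(2,4) show ?thesis
    using joined_equiv[of W E] unfolding components_def by (metis in_quotient_imp_closed)
qed

text \<open>Induction along a walk from \<open>w\<close> to \<open>v\<close>.\<close>
lemma component_propagate:
  assumes "simple_graph W E" "C \<in> components W E" "w \<in> C" "P w" "v \<in> C"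
    and step: "\<And>a b. {a, b} \<in> E \<Longrightarrow> a \<in> C \<Longrightarrow> b \<in> C \<Longrightarrow> P a \<Longrightarrow> P b"
  shows "P v"
proof -
  have "(w, v) \<in> joined W E"
    using joined_equiv[of W E] assms(2,3,5) unfolding components_def by (meson in_quotient_imp_in_rel insert_subset empty_subsetI)
  then have "(w, v) \<in> {(x, y). {x, y} \<in> E}\<^sup>*" by (simp add: joined_def)
  then have "v \<in> C \<and> P v"
  proof induction
    case base then show ?case using assms by simp
  next
    case (step y z)
    then have e: "{y, z} \<in> E" by simp
    have "z \<in> C" by (rule component_closed[OF assms(1,2) e]) (use step in simp)
    moreover have "P z" by (rule assms(6)[OF e]) (use step \<open>z \<in> C\<close> in auto)
    ultimately show ?case by simp
  qed
  then show ?thesis by simp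
qed

text \<open>Modulo the span of the incidence columns, adjacent vertices have opposite unit vectors, so every vertex
  of the component is congruent to \<open>w\<close> or to \<open>-w\<close>. If no vertex were congruent to both, the two classes
  would be a bipartition. Hence \<open>2 w\<close> lies in the span, and so does \<open>w\<close>.\<close>
lemma nonbipartite_unit_in_span:
  assumes "simple_graph W E" "C \<in> components W E" "\<not> bipartite_graph C (induced_edges E C)" "w \<in> C"
  shows "unit_vec w \<in> fun_space.span (incidence ` E)"
proof (rule ccontr)
  let ?S = "fun_space.span (incidence ` E)"
  assume not: "unit_vec w \<notin> ?S"
  define A where "A = {v\<in>C. unit_vec v - unit_vec w \<in> ?S}"
  define B where "B = {v\<in>C. unit_vec v + unit_vec w \<in> ?S}"
  have edge: "unit_vec a + unit_vec b \<in> ?S" if "{a, b} \<in> E" for a b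
  proof -
    have "a \<noteq> b" using that assms(1) by (auto simp: simple_graph_def)
    then show ?thesis using that incidence_edge fun_space.span_base by (metis imageI)
  qed
  have cover: "v \<in> A \<union> B" if "v \<in> C" for v
  proof (rule component_propagate[OF assms(1,2,4) _ that])
    show "w \<in> A \<union> B" using assms(4) by (auto simp: A_def fun_space.span_zero)
    fix a b assume ab: "{a, b} \<in> E" "a \<in> C" "b \<in> C" "a \<in> A \<union> B"
    from ab(4) show "b \<in> A \<union> B"
    proof
      assume "a \<in> A"
      then have "(unit_vec a + unit_vec b) - (unit_vec a - unit_vec w) \<in> ?S"
        using edge[OF ab(1)] by (intro fun_space.span_diff[of "unit_vec a + unit_vec b"]) (auto simp: A_def)
      then show ?thesis using ab by (simp add: B_def algebra_simps)
    next
      assume "a \<in> B"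
      then have "(unit_vec a + unit_vec b) - (unit_vec a + unit_vec w) \<in> ?S"
        using edge[OF ab(1)] by (intro fun_space.span_diff[of "unit_vec a + unit_vec b"]) (auto simp: B_def)
      then show ?thesis using ab by (simp add: A_def algebra_simps)
    qed
  qed
  have double: False if "unit_vec w + unit_vec w \<in> ?S"
  proof -
    have "fscale (1/2) (unit_vec w + unit_vec w) = (unit_vec w :: 'a \<Rightarrow> rat)"
      by (auto simp: fun_eq_iff fscale_apply)
    then show False using not fun_space.span_scale[OF that, of "1/2"] by metis
  qed
  have disj: "A \<inter> B = {}"
  proof (rule ccontr)
    assume "A \<inter> B \<noteq> {}"
    then obtain v where "v \<in> A" "v \<in> B" by auto
    then have "(unit_vec v + unit_vec w) - (unit_vec v - unit_vec w) \<in> ?S"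
      by (intro fun_space.span_diff[of "unit_vec v + unit_vec w"]) (auto simp: A_def B_def)
    then show False using double by (simp add: algebra_simps del: mult_2)
  qed
  have noAA: False if "{a, b} \<in> E" "a \<in> A" "b \<in> A" for a b
  proof -
    have "(unit_vec a + unit_vec b) - (unit_vec a - unit_vec w) - (unit_vec b - unit_vec w) \<in> ?S"
      using edge[OF that(1)] that(2,3)
      by (intro fun_space.span_diff[of _ _ "unit_vec b - unit_vec w"]
          fun_space.span_diff[of _ _ "unit_vec a - unit_vec w"]) (auto simp: A_def)
    then show False using double by (simp add: algebra_simps)
  qed
  have noBB: False if "{a, b} \<in> E" "a \<in> B" "b \<in> B" for a b
  proof -
    have "(unit_vec a + unit_vec w) + (unit_vec b + unit_vec w) - (unit_vec a + unit_vec b) \<in> ?S"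
      using edge[OF that(1)] that(2,3)
      by (intro fun_space.span_diff[of _ _ "unit_vec a + unit_vec b"]
          fun_space.span_add[of "unit_vec a + unit_vec w"]) (auto simp: B_def)
    then show False using double by (simp add: algebra_simps)
  qed
  have "bipartite_graph C (induced_edges E C)"
    unfolding bipartite_graph_def
  proof (rule exI[of _ A], rule exI[of _ B], intro conjI ballI)
    show "A \<union> B = C" using cover by (auto simp: A_def B_def)
    show "A \<inter> B = {}" by (rule disj)
    fix e assume "e \<in> induced_edges E C"
    then have e: "e \<in> E" "e \<subseteq> C" by (auto simp: induced_edges_def)
    from edge_obtain[OF assms(1) e(1)] obtain a b where ab: "e = {a, b}" "a \<noteq> b" by metis
    have "a \<in> A \<union> B" "b \<in> A \<union> B" using cover e ab by auto
    with noAA noBB e ab have "(a \<in> A \<and> b \<in> B) \<or> (b \<in> A \<and> a \<in> B)" by blast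
    then show "\<exists>a\<in>A. \<exists>b\<in>B. e = {a, b}" using ab(1) by (auto simp: insert_commute)
  qed
  with assms(3) show False by simp
qed

text \<open>The signs of a bipartition give a row relation of the incidence matrix supported on the component.\<close>
lemma bipartite_signs:
  assumes "simple_graph W E" "C \<in> components W E" "bipartite_graph C (induced_edges E C)"
  obtains y :: "'v \<Rightarrow> rat" where "\<And>v. v \<in> C \<Longrightarrow> y v \<noteq> 0" "\<And>v. v \<notin> C \<Longrightarrow> y v = 0"
    "\<And>e. e \<in> E \<Longrightarrow> (\<Sum>v\<in>W. y v * incidence e v) = 0"
proof -
  from assms(3) obtain A B where AB: "A \<union> B = C" "A \<inter> B = {}"
      "\<And>e. e \<in> induced_edges E C \<Longrightarrow> \<exists>a\<in>A. \<exists>b\<in>B. e = {a, b}"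
    unfolding bipartite_graph_def by auto
  define y :: "'v \<Rightarrow> rat" where "y v = (if v \<in> A then 1 else if v \<in> B then -1 else 0)" for v
  have "(\<Sum>v\<in>W. y v * incidence e v) = 0" if e: "e \<in> E" for e
  proof -
    from edge_obtain[OF assms(1) e] obtain a b
      where ab: "e = {a, b}" "a \<noteq> b" "a \<in> W" "b \<in> W" by metis
    have "(\<Sum>v\<in>W. y v * incidence e v) = (\<Sum>v\<in>W. if v \<in> {a, b} then y v else 0)"
      by (rule sum.cong) (auto simp: incidence_def ab)
    also have "\<dots> = (\<Sum>v\<in>{a, b}. y v)"
      using ab assms(1) by (subst sum.inter_restrict[symmetric]) (auto simp: simple_graph_def intro: sum.cong)
    also have "\<dots> = y a + y b" using ab by simp
    also have "\<dots> = 0"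
    proof (cases "a \<in> C")
      case True
      then have "b \<in> C" using component_closed[OF assms(1,2)] e ab by metis
      then have "e \<in> induced_edges E C" using e ab True by (auto simp: induced_edges_def)
      from AB(3)[OF this] obtain p q where "p \<in> A" "q \<in> B" "{a, b} = {p, q}" using ab by auto
      with AB(2) show ?thesis by (auto simp: y_def doubleton_eq_iff)
    next
      case False
      then have "b \<notin> C" using component_closed[OF assms(1,2), of b a] e ab
        by (metis insert_commute)
      with False AB(1) show ?thesis by (auto simp: y_def)
    qed
    finally show ?thesis .
  qed
  moreover have "\<And>v. v \<in> C \<Longrightarrow> y v \<noteq> 0" "\<And>v. v \<notin> C \<Longrightarrow> y v = 0"
    using AB by (auto simp: y_def)
  ultimately show ?thesis using that by blast
qed

text \<open>A maximal independent set of columns, together with the unit vector of one root in each bipartite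
  component, is a basis of the space of functions on the vertices. It spans because adjacent vertices have
  opposite unit vectors modulo the columns and because the unit vectors of non-bipartite components are
  in the span of the columns; it is independent because the signs of a bipartition annihilate all columns
  and all other roots. Thus the rank is the number of vertices minus the number of bipartite components.\<close>
lemma incidence_basis:
  assumes "simple_graph W E"
  obtains B where "B \<subseteq> E" "card B + num_bipartite_components W E = card W"
    "\<And>d. (\<And>v. (\<Sum>e\<in>B. d e * incidence e v) = 0) \<Longrightarrow> \<forall>e\<in>B. d e = 0"
    "\<And>e. e \<in> E \<Longrightarrow> \<exists>d. \<forall>v. incidence e v = (\<Sum>e'\<in>B. d e' * incidence e' v)"
proof -
  have finW: "finite W" using assms by (simp add: simple_graph_def)
  have finE: "finite E" by (rule finite_edges[OF assms])
  from fun_space.maximal_independent_subset[of "incidence ` E"] obtain B'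
    where B': "B' \<subseteq> incidence ` E" "fun_space.independent B'" "incidence ` E \<subseteq> fun_space.span B'"
    by blast
  define B where "B = {e \<in> E. incidence e \<in> B'}"
  have BE: "B \<subseteq> E" by (auto simp: B_def)
  then have finB: "finite B" using finE finite_subset by blast
  have iB: "incidence ` B = B'" using B'(1) by (auto simp: B_def)
  have injB: "inj_on incidence B" using inj_incidence inj_on_subset by blast
  have sumB: "(\<Sum>x\<in>B'. fscale (f x) x) = (\<Sum>e\<in>B. fscale (f (incidence e)) (incidence e))" for f
    unfolding iB[symmetric] by (subst sum.reindex[OF injB]) simp

  define Q where "Q = {C \<in> components W E. bipartite_graph C (induced_edges E C)}"
  have comp_sub: "C \<subseteq> W" "C \<noteq> {}" if "C \<in> components W E" for C
    using that in_quotient_imp_subset[OF joined_equiv] in_quotient_imp_non_empty[OF joined_equiv]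
    unfolding components_def by blast+
  define r where "r C = (SOME v. v \<in> C)" for C :: "'a set"
  have r: "r C \<in> C" if "C \<in> Q" for C
    using comp_sub(2) that unfolding r_def Q_def by (metis (lifting) equals0I mem_Collect_eq someI_ex)
  have disj: "v \<notin> D" if "C \<in> components W E" "D \<in> components W E" "C \<noteq> D" "v \<in> C" for C D v
    using quotient_disj[OF joined_equiv[of W E]] that unfolding components_def by blast
  have injr: "inj_on r Q"
    by (rule inj_onI) (metis (lifting) Q_def disj mem_Collect_eq r)
  have finQ: "finite Q"
  proof (rule finite_subset)
    show "Q \<subseteq> Pow W" using comp_sub(1) by (auto simp: Q_def)
    show "finite (Pow W)" using finW by simp
  qed
  have ind: "fun_space.independent (B' \<union> (unit_vec \<circ> r) ` P) \<and> B' \<inter> (unit_vec \<circ> r) ` P = {}" if "P \<subseteq> Q" for P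
    using finite_subset[OF that finQ] that
  proof induction
    case empty then show ?case using B' by simp
  next
    case (insert C P)
    have CQ: "C \<in> Q" using insert by simp
    then have C: "C \<in> components W E" "bipartite_graph C (induced_edges E C)" by (auto simp: Q_def)
    from bipartite_signs[OF assms C] obtain y :: "'a \<Rightarrow> rat" where y: "\<And>v. v \<in> C \<Longrightarrow> y v \<noteq> 0"
      "\<And>v. v \<notin> C \<Longrightarrow> y v = 0" "\<And>e. e \<in> E \<Longrightarrow> (\<Sum>v\<in>W. y v * incidence e v) = 0" by metis
    have yu: "(\<Sum>v\<in>W. y v * unit_vec w v) = y w" if "w \<in> W" for w
      using that finW by (simp add: unit_vec_def if_distrib sum.delta cong: if_cong)
    have new: "unit_vec (r C) \<notin> fun_space.span (B' \<union> (unit_vec \<circ> r) ` P)"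
    proof
      assume *: "unit_vec (r C) \<in> fun_space.span (B' \<union> (unit_vec \<circ> r) ` P)"
      have "(\<Sum>v\<in>W. y v * unit_vec (r C) v) = 0"
      proof (rule span_vanishing[OF _ *])
        fix f assume "f \<in> B' \<union> (unit_vec \<circ> r) ` P"
        then consider e where "e \<in> E" "f = incidence e" | D where "D \<in> P" "f = unit_vec (r D)"
          using B'(1) by auto
        then show "(\<Sum>v\<in>W. y v * f v) = 0"
        proof cases
          case 1 then show ?thesis using y(3) by simp
        next
          case 2
          then have D: "D \<in> Q" "D \<noteq> C" using insert by auto
          then have "r D \<in> D" "D \<in> components W E" using r by (auto simp: Q_def)
          then have "r D \<notin> C" "r D \<in> W" using disj[of D C] C D comp_sub by auto
          then show ?thesis using 2 yu y(2) by simp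
        qed
      qed
      moreover have "r C \<in> W" using r[OF CQ] comp_sub(1)[OF C(1)] by auto
      ultimately show False using yu y(1) r[OF CQ] by simp
    qed
    have IH: "fun_space.independent (B' \<union> (unit_vec \<circ> r) ` P)" "B' \<inter> (unit_vec \<circ> r) ` P = {}"
      using insert by auto
    have "unit_vec (r C) \<notin> B'" using new fun_space.span_base by blast
    then show ?case using fun_space.independent_insertI[OF new IH(1)] IH(2) by simp
  qed
  define T where "T = B' \<union> (unit_vec \<circ> r) ` Q"
  have indT: "fun_space.independent T" "B' \<inter> (unit_vec \<circ> r) ` Q = {}" using ind[of Q] by (auto simp: T_def)
  have finT: "finite T" using finB finQ iB by (auto simp: T_def)
  have "inj_on (unit_vec \<circ> r :: 'a set \<Rightarrow> 'a \<Rightarrow> rat) Q"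
    using injr inj_unit_vec by (metis comp_inj_on inj_on_subset subset_UNIV)
  then have "card ((unit_vec \<circ> r :: 'a set \<Rightarrow> 'a \<Rightarrow> rat) ` Q) = card Q"
    by (rule card_image)
  moreover have "card B' = card B" unfolding iB[symmetric] by (rule card_image[OF injB])
  ultimately have cardT: "card T = card B + card Q"
    using card_Un_disjoint[OF _ _ indT(2)] finT by (simp add: T_def)
  have spanE: "fun_space.span (incidence ` E) \<subseteq> fun_space.span T"
  proof (rule fun_space.span_minimal)
    have "fun_space.span B' \<subseteq> fun_space.span T" by (rule fun_space.span_mono) (simp add: T_def)
    then show "incidence ` E \<subseteq> fun_space.span T" using B'(3) by auto
  qed simp
  have unitT: "unit_vec v \<in> fun_space.span T" if v: "v \<in> W" for v
  proof -
    define C where "C = joined W E `` {v}"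
    have C: "C \<in> components W E" using v by (auto simp: C_def components_def quotientI)
    have vC: "v \<in> C" using v by (auto simp: C_def joined_def)
    obtain w where w: "w \<in> C" "unit_vec w \<in> fun_space.span T"
    proof (cases "C \<in> Q")
      case True
      then show ?thesis using that[of "r C"] r fun_space.span_base[of _ T] by (auto simp: T_def)
    next
      case False
      then have "unit_vec v \<in> fun_space.span (incidence ` E)"
        using nonbipartite_unit_in_span[OF assms C _ vC] C by (auto simp: Q_def)
      then show ?thesis using that vC spanE by blast
    qed
    show ?thesis
    proof (rule component_propagate[OF assms C w(1) _ vC])
      show "unit_vec w \<in> fun_space.span T" by (rule w(2))
      fix a b assume ab: "{a, b} \<in> E" "unit_vec a \<in> fun_space.span T"
      then have "a \<noteq> b" using assms by (auto simp: simple_graph_def)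
      then have "unit_vec a + unit_vec b \<in> fun_space.span T"
        using ab(1) incidence_edge spanE fun_space.span_base by (metis imageI subsetD)
      then have "unit_vec a + unit_vec b - unit_vec a \<in> fun_space.span T"
        using ab(2) by (rule fun_space.span_diff)
      then show "unit_vec b \<in> fun_space.span T" by simp
    qed
  qed
  have "card (unit_vec ` W :: ('a \<Rightarrow> rat) set) \<le> card T"
    using fun_space.independent_span_bound[OF finT independent_unit_vecs[of W]] unitT by blast
  moreover have "card T \<le> card (unit_vec ` W :: ('a \<Rightarrow> rat) set)"
  proof -
    have "f \<in> fun_space.span (unit_vec ` W)" if "f \<in> T" for f
    proof (rule in_span_unit_vecs[OF finW])
      fix j assume j: "j \<notin> W"
      from that consider e where "e \<in> E" "f = incidence e" | D where "D \<in> Q" "f = unit_vec (r D)"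
        using B'(1) by (auto simp: T_def)
      then show "f j = 0"
      proof cases
        case 1
        then have "e \<subseteq> W" using assms by (simp add: simple_graph_def)
        then show ?thesis using 1 j by (auto simp: incidence_def)
      next
        case 2
        then have "r D \<in> W" using r comp_sub by (auto simp: Q_def)
        then show ?thesis using 2 j by (auto simp: unit_vec_def)
      qed
    qed
    then show ?thesis using fun_space.independent_span_bound[OF _ indT(1)] finW by blast
  qed
  moreover have "card (unit_vec ` W :: ('a \<Rightarrow> rat) set) = card W"
    using inj_unit_vec by (metis card_image inj_on_subset subset_UNIV)
  ultimately have "card B + card Q = card W" using cardT by simp
  then have 1: "card B + num_bipartite_components W E = card W"
    by (simp add: num_bipartite_components_def Q_def)
  have 2: "\<forall>e\<in>B. d e = 0" if d: "\<And>v. (\<Sum>e\<in>B. d e * incidence e v) = 0" for d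
  proof
    fix e assume e: "e \<in> B"
    define f where "f = d \<circ> inv_into UNIV incidence"
    have f: "f (incidence e) = d e" for e by (simp add: f_def inv_f_f[OF inj_incidence])
    have "(\<Sum>x\<in>B'. fscale (f x) x) = 0"
      unfolding sumB using d by (simp add: f fun_eq_iff fscale_apply)
    then have "f (incidence e) = 0"
      using fun_space.independentD[OF B'(2) _ subset_refl, of f "incidence e"] finB iB e by blast
    then show "d e = 0" by (simp add: f)
  qed
  have 3: "\<exists>d. \<forall>v. incidence e v = (\<Sum>e'\<in>B. d e' * incidence e' v)" if "e \<in> E" for e
  proof -
    have "finite B'" using finB iB by blast
    have "incidence e \<in> fun_space.span B'" using B'(3) that by blast
    from this obtain f where "incidence e = (\<Sum>x\<in>B'. fscale (f x) x)"
      unfolding fun_space.span_finite[OF \<open>finite B'\<close>] by blast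
    then have "incidence e v = (\<Sum>e'\<in>B. f (incidence e') * incidence e' v)" for v
      unfolding sumB by (simp add: fscale_apply)
    then show ?thesis by (intro exI[of _ "f \<circ> incidence"]) simp
  qed
  show ?thesis by (rule that[OF BE 1 2 3])
qed

definition cycle_space :: "'v set set \<Rightarrow> ('v set \<Rightarrow> rat) set" where
  "cycle_space E = {w. (\<forall>e. e \<notin> E \<longrightarrow> w e = 0) \<and> (\<forall>v. (\<Sum>e\<in>E. w e * incidence e v) = 0)}"

text \<open>An independent family in the cycle space stays independent when the unit vectors of the edges in a
  column basis are added, since no nonzero relation is supported on a column basis.\<close>
lemma cycle_space_independent_le:
  assumes "simple_graph W E" "finite I"
    and u: "\<And>i. i \<in> I \<Longrightarrow> u i \<in> cycle_space E"
    and indep: "\<And>c. (\<And>e. (\<Sum>i\<in>I. c i * u i e) = 0) \<Longrightarrow> \<forall>i\<in>I. c i = 0"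
  shows "card I + card W \<le> card E + num_bipartite_components W E"
proof -
  from incidence_basis[OF assms(1)] obtain B where B: "B \<subseteq> E"
    "card B + num_bipartite_components W E = card W"
    "\<And>d. (\<And>v. (\<Sum>e\<in>B. d e * incidence e v) = 0) \<Longrightarrow> \<forall>e\<in>B. d e = 0"
    by metis
  have finE: "finite E" by (rule finite_edges[OF assms(1)])
  then have finB: "finite B" using B(1) finite_subset by blast
  define M :: "'b + 'a set \<Rightarrow> 'a set \<Rightarrow> rat"
    where "M = case_sum u unit_vec"
  have "card (Sum_Type.Plus I B) \<le> card E"
  proof (rule independent_rows_le_columns)
    show "finite (Sum_Type.Plus I B)" "finite E" using finB finE assms(2) by auto
    fix c assume c: "\<And>e. e \<in> E \<Longrightarrow> (\<Sum>i\<in>Sum_Type.Plus I B. c i * M i e) = 0"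
    have c': "(\<Sum>i\<in>I. c (Inl i) * u i e) + (if e \<in> B then c (Inr e) else 0) = 0" if "e \<in> E" for e
    proof -
      have "(\<Sum>b\<in>B. c (Inr b) * unit_vec b e) = (\<Sum>b\<in>B. if b = e then c (Inr b) else 0)"
        by (rule sum.cong) (auto simp: unit_vec_def)
      also have "\<dots> = (if e \<in> B then c (Inr e) else 0)" using finB by (simp add: sum.delta')
      finally show ?thesis using c[OF that] assms(2) finB by (simp add: sum.Plus M_def)
    qed
    have "(\<Sum>e\<in>B. c (Inr e) * incidence e v) = 0" for v
    proof -
      have "0 = (\<Sum>e\<in>E. ((\<Sum>i\<in>I. c (Inl i) * u i e) + (if e \<in> B then c (Inr e) else 0)) * incidence e v)"
        using c' by simp
      also have "\<dots> = (\<Sum>e\<in>E. (\<Sum>i\<in>I. c (Inl i) * u i e * incidence e v))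
          + (\<Sum>e\<in>E. if e \<in> B then c (Inr e) * incidence e v else 0)"
        unfolding sum.distrib[symmetric] by (rule sum.cong) (auto simp: algebra_simps sum_distrib_left)
      also have "(\<Sum>e\<in>E. (\<Sum>i\<in>I. c (Inl i) * u i e * incidence e v))
          = (\<Sum>i\<in>I. c (Inl i) * (\<Sum>e\<in>E. u i e * incidence e v))"
        by (subst sum.swap) (simp add: sum_distrib_left mult.assoc)
      also have "\<dots> = 0" using u by (simp add: cycle_space_def)
      also have "(\<Sum>e\<in>E. if e \<in> B then c (Inr e) * incidence e v else 0)
          = (\<Sum>e\<in>E \<inter> B. c (Inr e) * incidence e v)"
        by (rule sum.inter_restrict[OF finE, symmetric])
      also have "E \<inter> B = B" using B(1) by auto
      finally show ?thesis by simp
    qed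
    from B(3)[of "\<lambda>e. c (Inr e)", OF this] have cB: "\<forall>e\<in>B. c (Inr e) = 0" .
    have "(\<Sum>i\<in>I. c (Inl i) * u i e) = 0" for e
    proof (cases "e \<in> E")
      case True then show ?thesis using c'[OF True] cB by (auto split: if_splits)
    next
      case False
      then have "u i e = 0" if "i \<in> I" for i using u[OF that] by (simp add: cycle_space_def)
      then show ?thesis by simp
    qed
    from indep[of "\<lambda>i. c (Inl i)", OF this] cB show "\<forall>i\<in>Sum_Type.Plus I B. c i = 0" by auto
  qed
  then show ?thesis using B(2) finB assms(2) by (simp add: card_Plus)
qed

text \<open>Expressing each column in a column basis gives a cycle-space element for each edge \<open>e\<close> which differs
  from the unit vector of \<open>e\<close> only on that basis. So a spanning family of the cycle space and the unit
  vectors of the basis edges together generate all unit vectors.\<close>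
lemma cycle_space_spanning_ge:
  assumes "simple_graph W E" "finite I"
    and span: "\<And>w. w \<in> cycle_space E \<Longrightarrow> \<exists>c. \<forall>e. w e = (\<Sum>i\<in>I. c i * u i e)"
  shows "card E + num_bipartite_components W E \<le> card I + card W"
proof -
  from incidence_basis[OF assms(1)] obtain B where B: "B \<subseteq> E"
    "card B + num_bipartite_components W E = card W"
    "\<And>e. e \<in> E \<Longrightarrow> \<exists>d. \<forall>v. incidence e v = (\<Sum>e'\<in>B. d e' * incidence e' v)"
    by metis
  have finE: "finite E" by (rule finite_edges[OF assms(1)])
  then have finB: "finite B" using B(1) finite_subset by blast
  from B(3) obtain d where d: "\<And>e v. e \<in> E \<Longrightarrow> incidence e v = (\<Sum>e'\<in>B. d e e' * incidence e' v)"
    by metis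
  define w where "w e f = unit_vec e f - (if f \<in> B then d e f else 0)" for e f
  have "w e \<in> cycle_space E" if e: "e \<in> E" for e
    unfolding cycle_space_def
  proof (intro CollectI conjI allI impI)
    fix f assume "f \<notin> E" then show "w e f = 0" using e B(1) by (auto simp: w_def unit_vec_def)
  next
    fix v
    have "(\<Sum>f\<in>E. w e f * incidence f v) = (\<Sum>f\<in>E. if f = e then incidence f v else 0)
        - (\<Sum>f\<in>E. if f \<in> B then d e f * incidence f v else 0)"
      unfolding sum_subtractf[symmetric] by (rule sum.cong) (auto simp: w_def unit_vec_def algebra_simps)
    also have "(\<Sum>f\<in>E. if f = e then incidence f v else 0) = incidence e v" using e finE by simp
    also have "(\<Sum>f\<in>E. if f \<in> B then d e f * incidence f v else 0) = (\<Sum>f\<in>E \<inter> B. d e f * incidence f v)"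
      by (rule sum.inter_restrict[OF finE, symmetric])
    also have "E \<inter> B = B" using B(1) by auto
    finally show "(\<Sum>f\<in>E. w e f * incidence f v) = 0" using d[OF e, of v] by simp
  qed
  then have "\<forall>e\<in>E. \<exists>c. \<forall>f. w e f = (\<Sum>i\<in>I. c i * u i f)" using span by blast
  then obtain c where c: "\<And>e f. e \<in> E \<Longrightarrow> w e f = (\<Sum>i\<in>I. c e i * u i f)" by metis
  have "card E \<le> card (Sum_Type.Plus I B)"
  proof (rule identity_factorization_le)
    show "finite E" "finite (Sum_Type.Plus I B)" using finE finB assms(2) by auto
    fix e f assume e: "e \<in> E" and f: "f \<in> E"
    have "(\<Sum>s\<in>Sum_Type.Plus I B. case_sum (c e) (d e) s * case_sum u unit_vec s f)
        = (\<Sum>i\<in>I. c e i * u i f) + (\<Sum>b\<in>B. d e b * unit_vec b f)"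
      using finB assms(2) by (simp add: sum.Plus)
    also have "(\<Sum>b\<in>B. d e b * unit_vec b f) = (\<Sum>b\<in>B. if b = f then d e b else 0)"
      by (rule sum.cong) (auto simp: unit_vec_def)
    also have "\<dots> = (if f \<in> B then d e f else 0)" using finB by (simp add: sum.delta')
    also have "(\<Sum>i\<in>I. c e i * u i f) = w e f" using c[OF e] by simp
    finally show "(\<Sum>s\<in>Sum_Type.Plus I B. case_sum (c e) (d e) s * case_sum u unit_vec s f) = (if e = f then 1 else 0)"
      by (auto simp: w_def unit_vec_def)
  qed
  then show ?thesis using B(2) finB assms(2) by (simp add: card_Plus)
qed

section \<open>Polynomials, gradings and toric ideals\<close>

abbreviation (input) "monomial m \<equiv> Poly_Mapping.single m 1"

text \<open>The linear functional with value \<open>\<phi> m\<close> on the monomial \<open>m\<close>.\<close>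
definition lsum :: "('m \<Rightarrow> 'k) \<Rightarrow> ('m \<Rightarrow>\<^sub>0 'k::field) \<Rightarrow> 'k" where
  "lsum \<phi> p = (\<Sum>m\<in>Poly_Mapping.keys p. \<phi> m * Poly_Mapping.lookup p m)"

lemma lsum_superset:
  assumes "finite K" "Poly_Mapping.keys p \<subseteq> K"
  shows "lsum \<phi> p = (\<Sum>m\<in>K. \<phi> m * Poly_Mapping.lookup p m)"
  unfolding lsum_def using assms
  by (intro sum.mono_neutral_left) (auto simp: in_keys_iff)

lemma lsum_zero [simp]: "lsum \<phi> 0 = 0"
  by (simp add: lsum_def)

lemma lsum_single [simp]: "lsum \<phi> (Poly_Mapping.single m c) = \<phi> m * c"
  by (simp add: lsum_def)

lemma lsum_add: "lsum \<phi> (p + q) = lsum \<phi> p + lsum \<phi> q"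
  using keys_add[of p q]
  by (simp add: lsum_superset[of "Poly_Mapping.keys p \<union> Poly_Mapping.keys q"] lookup_add
      algebra_simps sum.distrib)

lemma lsum_uminus: "lsum \<phi> (- p) = - lsum \<phi> p"
  by (simp add: lsum_def sum_negf)

lemma lsum_diff: "lsum \<phi> (p - q) = lsum \<phi> p - lsum \<phi> q"
  using lsum_add[of \<phi> p "- q"] by (simp add: lsum_uminus)

lemma lsum_sum: "lsum \<phi> (\<Sum>i\<in>I. f i) = (\<Sum>i\<in>I. lsum \<phi> (f i))"
  by (induction I rule: infinite_finite_induct) (auto simp: lsum_add)

lemma poly_expand: "p = (\<Sum>m\<in>Poly_Mapping.keys p. Poly_Mapping.single m (Poly_Mapping.lookup p m))"
  by (rule poly_mapping_eqI)
    (auto simp: lookup_sum lookup_single when_def sum.delta in_keys_iff)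

lemma poly_induct [case_names zero single add]:
  fixes p :: "'m \<Rightarrow>\<^sub>0 'b::comm_monoid_add"
  assumes "P 0" "\<And>m. m \<in> Poly_Mapping.keys p \<Longrightarrow> P (Poly_Mapping.single m (Poly_Mapping.lookup p m))"
    "\<And>q r. P q \<Longrightarrow> P r \<Longrightarrow> P (q + r)"
  shows "P p"
proof -
  have "P (\<Sum>m\<in>K. Poly_Mapping.single m (Poly_Mapping.lookup p m))"
    if "finite K" "K \<subseteq> Poly_Mapping.keys p" for K
    using that by induction (use assms in auto)
  from this[of "Poly_Mapping.keys p"] show ?thesis using poly_expand[of p] by simp
qed

text \<open>The projection onto the span of the monomials satisfying \<open>Q\<close>. With \<open>Q\<close> a condition on a degree, it
  extracts homogeneous components, and sums of these, without any subtraction of degrees.\<close>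
definition filt :: "('m \<Rightarrow> bool) \<Rightarrow> ('m \<Rightarrow>\<^sub>0 'k::field) \<Rightarrow> 'm \<Rightarrow>\<^sub>0 'k" where
  "filt Q p = (\<Sum>m\<in>{m\<in>Poly_Mapping.keys p. Q m}. Poly_Mapping.single m (Poly_Mapping.lookup p m))"

lemma lookup_filt: "Poly_Mapping.lookup (filt Q p) m = (if Q m then Poly_Mapping.lookup p m else 0)"
  by (auto simp: filt_def lookup_sum lookup_single when_def sum.delta in_keys_iff)

lemma keys_filt: "Poly_Mapping.keys (filt Q p) = {m \<in> Poly_Mapping.keys p. Q m}"
  by (auto simp: in_keys_iff lookup_filt split: if_splits)

lemma filt_zero [simp]: "filt Q 0 = 0"
  by (rule poly_mapping_eqI) (simp add: lookup_filt)

lemma filt_add: "filt Q (p + q) = filt Q p + filt Q q"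
  by (rule poly_mapping_eqI) (simp add: lookup_filt lookup_add)

lemma filt_sum: "filt Q (\<Sum>i\<in>I. f i) = (\<Sum>i\<in>I. filt Q (f i))"
  by (induction I rule: infinite_finite_induct) (auto simp: filt_add)

lemma filt_single: "filt Q (Poly_Mapping.single m c) = (if Q m then Poly_Mapping.single m c else 0)"
  by (rule poly_mapping_eqI) (auto simp: lookup_filt lookup_single when_def)

lemma filt_id: "(\<And>m. m \<in> Poly_Mapping.keys p \<Longrightarrow> Q m) \<Longrightarrow> filt Q p = p"
  by (rule poly_mapping_eqI) (auto simp: lookup_filt in_keys_iff)

text \<open>A term \<open>c\<close> of \<open>g\<close> contributes to the product only terms of degree \<open>\<delta> c + d\<close>.\<close>
lemma filt_mult_homogeneous:
  fixes f g :: "'m::comm_monoid_add \<Rightarrow>\<^sub>0 'k::field"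
  assumes add: "\<And>m n. \<delta> (m + n) = \<delta> m + \<delta> n"
    and hom: "\<And>m. m \<in> Poly_Mapping.keys f \<Longrightarrow> \<delta> m = d"
  shows "filt (\<lambda>m. Q (\<delta> m)) (g * f) = filt (\<lambda>m. Q (\<delta> m + d)) g * f"
proof (induction g rule: poly_induct)
  case zero then show ?case by simp
next
  case (add q r) then show ?case by (simp add: filt_add distrib_right)
next
  case (single c)
  define x where "x = Poly_Mapping.lookup g c"
  have "filt (\<lambda>m. Q (\<delta> m)) (Poly_Mapping.single c x * f)
      = (if Q (\<delta> c + d) then Poly_Mapping.single c x * f else 0)"
  proof (induction f rule: poly_induct)
    case zero then show ?case by simp
  next
    case (add q r) then show ?case by (simp add: filt_add distrib_left)
  next
    case (single m)
    then show ?case using hom by (simp add: mult_single filt_single add)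
  qed
  then show ?case by (simp add: filt_single x_def)
qed

text \<open>Taking constant terms is multiplicative because only \<open>0 + 0\<close> is \<open>0\<close> among exponents.\<close>
lemma lookup_mult_zero:
  fixes p q :: "('x, 'k::field) mpoly"
  shows "Poly_Mapping.lookup (p * q) 0 = Poly_Mapping.lookup p 0 * Poly_Mapping.lookup q 0"
proof (induction p rule: poly_induct)
  case zero then show ?case by simp
next
  case (add a b) then show ?case by (simp add: lookup_add distrib_right)
next
  case (single m)
  show ?case
  proof (induction q rule: poly_induct)
    case zero then show ?case by simp
  next
    case (add a b) then show ?case by (simp add: lookup_add distrib_left)
  next
    case (single n)
    have "m + n = 0 \<longleftrightarrow> m = 0 \<and> n = 0"
      by (auto simp: poly_mapping_eq_iff fun_eq_iff lookup_add)
    then show ?case by (auto simp: mult_single lookup_single when_def)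
  qed
qed

lemma indets_sum: "(\<And>i. i \<in> I \<Longrightarrow> indets (f i) \<subseteq> X) \<Longrightarrow> indets (\<Sum>i\<in>I. f i) \<subseteq> X"
proof (induction I rule: infinite_finite_induct)
  case (insert i I)
  then show ?case using indets_add[of "f i" "sum f I"] by auto
qed (auto simp: indets_zero)

lemma indets_single: "indets (Poly_Mapping.single m c) \<subseteq> Poly_Mapping.keys m"
  by (auto simp: indets_def)

lemma indets_filt: "indets (filt Q p) \<subseteq> indets p"
  by (auto simp: indets_def keys_filt)

lemma indets_diff: "indets (p - q :: ('x, 'k::field) mpoly) \<subseteq> indets p \<union> indets q"
  using indets_add[of p "- q"] by (simp add: indets_uminus)

lemma indets_mult_subset:
  fixes p q :: "('x, 'k::field) mpoly"
  shows "indets p \<subseteq> X \<Longrightarrow> indets q \<subseteq> X \<Longrightarrow> indets (p * q) \<subseteq> X"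
  using indets_mult[of p q] by auto

lemma indets_add_subset: "indets p \<subseteq> X \<Longrightarrow> indets q \<subseteq> X \<Longrightarrow> indets (p + q) \<subseteq> X"
  using indets_add[of p q] by auto

lemma indets_diff_subset:
  fixes p q :: "('x, 'k::field) mpoly"
  shows "indets p \<subseteq> X \<Longrightarrow> indets q \<subseteq> X \<Longrightarrow> indets (p - q) \<subseteq> X"
  using indets_diff[of p q] by auto

lemma ideal_poly_ringI:
  fixes I :: "('x, 'k::field) mpoly set"
  assumes "\<And>p. p \<in> I \<Longrightarrow> indets p \<subseteq> X" "0 \<in> I" "\<And>p q. p \<in> I \<Longrightarrow> q \<in> I \<Longrightarrow> p + q \<in> I"
    and mult: "\<And>p q. p \<in> I \<Longrightarrow> indets q \<subseteq> X \<Longrightarrow> q * p \<in> I"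
  shows "ideal I (poly_ring X)"
proof -
  let ?R = "poly_ring X :: ('x, 'k) mpoly ring"
  interpret R: cring ?R by (rule poly_ring_cring)
  have neg: "- p \<in> I" if "p \<in> I" for p
    using mult[OF that, of "-1"] by (simp add: indets_uminus indets_one)
  have inv: "\<ominus>\<^bsub>?R\<^esub> p = - p" if "p \<in> I" for p
    using assms(1)[OF that] by (intro R.minus_equality) (auto simp: poly_ring_def indets_uminus)
  show ?thesis
  proof (rule idealI)
    show "ring ?R" by (rule R.ring_axioms)
    show "subgroup I (add_monoid ?R)"
    proof (rule subgroup.intro)
      show "inv\<^bsub>add_monoid ?R\<^esub> p \<in> I" if "p \<in> I" for p
        using inv[OF that] neg[OF that] by (simp add: a_inv_def)
    qed (use assms in \<open>auto simp: poly_ring_def\<close>)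
  qed (use mult in \<open>auto simp: poly_ring_def mult.commute\<close>)
qed

lemma ideal_poly_ringD:
  fixes I :: "('x, 'k::field) mpoly set"
  assumes "ideal I (poly_ring X)"
  shows "p \<in> I \<Longrightarrow> indets p \<subseteq> X" "0 \<in> I" "p \<in> I \<Longrightarrow> q \<in> I \<Longrightarrow> p + q \<in> I"
    "p \<in> I \<Longrightarrow> indets q \<subseteq> X \<Longrightarrow> q * p \<in> I"
  using additive_subgroup.a_subset[OF ideal.axioms(1)[OF assms]]
    additive_subgroup.zero_closed[OF ideal.axioms(1)[OF assms]]
    additive_subgroup.a_closed[OF ideal.axioms(1)[OF assms]]
    ideal.I_l_closed[OF assms]
  by (auto simp: poly_ring_def)

text \<open>The ideal generated by a finite indexed family. Families are used because \<open>x^a - x^b\<close> and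
  \<open>x^b - x^a\<close> coincide in characteristic two, so that distinct pairs may give equal binomials.\<close>
definition lin_comb :: "'x set \<Rightarrow> 'i set \<Rightarrow> ('i \<Rightarrow> ('x, 'k::field) mpoly) \<Rightarrow> ('x, 'k) mpoly set" where
  "lin_comb X I b = {p. \<exists>g. (\<forall>i. indets (g i) \<subseteq> X) \<and> p = (\<Sum>i\<in>I. g i * b i)}"

lemma lin_combI: "(\<And>i. indets (g i) \<subseteq> X) \<Longrightarrow> (\<Sum>i\<in>I. g i * b i) \<in> lin_comb X I b"
  by (auto simp: lin_comb_def)

lemma lin_combE:
  assumes "p \<in> lin_comb X I b"
  obtains g where "\<And>i. indets (g i) \<subseteq> X" "p = (\<Sum>i\<in>I. g i * b i)"
  using assms by (auto simp: lin_comb_def)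

lemma lin_comb_base:
  assumes "finite I" "i \<in> I"
  shows "b i \<in> lin_comb X I b"
proof -
  have "(\<Sum>j\<in>I. (if j = i then 1 else 0) * b j) \<in> lin_comb X I b"
    by (rule lin_combI) (auto simp: indets_zero indets_one)
  then show ?thesis using assms by (simp add: if_distrib[of "\<lambda>x. x * _"] sum.delta cong: if_cong)
qed

lemma ideal_lin_comb:
  fixes b :: "'i \<Rightarrow> ('x, 'k::field) mpoly"
  assumes "\<And>i. i \<in> I \<Longrightarrow> indets (b i) \<subseteq> X"
  shows "ideal (lin_comb X I b) (poly_ring X)"
proof (rule ideal_poly_ringI)
  fix p assume "p \<in> lin_comb X I b"
  then obtain g where g: "\<And>i. indets (g i) \<subseteq> X" "p = (\<Sum>i\<in>I. g i * b i)" by (rule lin_combE) blast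
  show "indets p \<subseteq> X" unfolding g(2) using g(1) assms by (intro indets_sum indets_mult_subset) auto
  fix q :: "('x, 'k) mpoly" assume q: "indets q \<subseteq> X"
  have "q * p = (\<Sum>i\<in>I. (q * g i) * b i)" by (simp add: g(2) sum_distrib_left mult.assoc)
  also have "\<dots> \<in> lin_comb X I b" using q g(1) by (intro lin_combI indets_mult_subset)
  finally show "q * p \<in> lin_comb X I b" .
next
  have "(\<Sum>i\<in>I. 0 * b i) \<in> lin_comb X I b" by (rule lin_combI) (auto simp: indets_zero)
  then show "0 \<in> lin_comb X I b" by simp
next
  fix p q assume "p \<in> lin_comb X I b" "q \<in> lin_comb X I b"
  then obtain g h where g: "\<And>i. indets (g i) \<subseteq> X" "p = (\<Sum>i\<in>I. g i * b i)"
    and h: "\<And>i. indets (h i) \<subseteq> X" "q = (\<Sum>i\<in>I. h i * b i)"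
    unfolding lin_comb_def by blast
  have "p + q = (\<Sum>i\<in>I. (g i + h i) * b i)" by (simp add: g h distrib_right sum.distrib)
  also have "\<dots> \<in> lin_comb X I b" using g(1) h(1) by (intro lin_combI indets_add_subset)
  finally show "p + q \<in> lin_comb X I b" .
qed

lemma ideal_poly_ring_sum:
  assumes "ideal J (poly_ring X)" "\<And>i. i \<in> I \<Longrightarrow> f i \<in> J"
  shows "(\<Sum>i\<in>I. f i) \<in> J"
  using assms(2)
  by (induction I rule: infinite_finite_induct)
    (auto intro: ideal_poly_ringD(2)[OF assms(1)] ideal_poly_ringD(3)[OF assms(1)])

lemma lin_comb_least:
  assumes "ideal J (poly_ring X)" "\<And>i. i \<in> I \<Longrightarrow> b i \<in> J"
  shows "lin_comb X I b \<subseteq> J"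
proof
  fix p assume "p \<in> lin_comb X I b"
  then obtain g where g: "\<And>i. indets (g i) \<subseteq> X" "p = (\<Sum>i\<in>I. g i * b i)" by (rule lin_combE) blast
  show "p \<in> J" unfolding g(2)
    using assms g(1) by (intro ideal_poly_ring_sum[OF assms(1)] ideal_poly_ringD(4)[OF assms(1)]) auto
qed

lemma genideal_lin_comb:
  fixes b :: "'i \<Rightarrow> ('x, 'k::field) mpoly"
  assumes "finite I" "\<And>i. i \<in> I \<Longrightarrow> indets (b i) \<subseteq> X"
  shows "genideal (poly_ring X) (b ` I) = lin_comb X I b"
proof
  interpret R: cring "poly_ring X :: ('x, 'k) mpoly ring" by (rule poly_ring_cring)
  have sub: "b ` I \<subseteq> carrier (poly_ring X)" using assms(2) by (auto simp: poly_ring_def)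
  show "genideal (poly_ring X) (b ` I) \<subseteq> lin_comb X I b"
  proof (rule R.genideal_minimal)
    show "ideal (lin_comb X I b) (poly_ring X)" using assms(2) by (rule ideal_lin_comb)
    show "b ` I \<subseteq> lin_comb X I b" using lin_comb_base[OF assms(1)] by (auto simp: image_subset_iff)
  qed
  show "lin_comb X I b \<subseteq> genideal (poly_ring X) (b ` I)"
  proof (rule lin_comb_least[OF R.genideal_ideal[OF sub]])
    show "b i \<in> genideal (poly_ring X) (b ` I)" if "i \<in> I" for i
      using R.genideal_self[OF sub] imageI[OF that] by (rule subsetD)
  qed
qed

text \<open>The degree in the vertex variables, with the vertices renamed by \<open>c\<close>: the monomial \<open>m\<close> in the edge
  variables is mapped to the monomial \<open>deg m\<close> in the vertex variables. Renaming to natural numbers gives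
  access to the integrality of polynomial rings with linearly ordered exponents.\<close>
definition vdeg :: "('v \<Rightarrow> 'w) \<Rightarrow> ('v set \<Rightarrow>\<^sub>0 nat) \<Rightarrow> ('w \<Rightarrow>\<^sub>0 nat)" where
  "vdeg c m = (\<Sum>e\<in>Poly_Mapping.keys m. \<Sum>v\<in>e. Poly_Mapping.single (c v) (Poly_Mapping.lookup m e))"

abbreviation "deg \<equiv> vdeg (\<lambda>v. v)"

lemma vdeg_superset:
  assumes "finite K" "Poly_Mapping.keys m \<subseteq> K"
  shows "vdeg c m = (\<Sum>e\<in>K. \<Sum>v\<in>e. Poly_Mapping.single (c v) (Poly_Mapping.lookup m e))"
  unfolding vdeg_def using assms
  by (intro sum.mono_neutral_left) (auto simp: in_keys_iff)

lemma vdeg_zero [simp]: "vdeg c 0 = 0"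
  by (simp add: vdeg_def)

lemma vdeg_add: "vdeg c (m + n) = vdeg c m + vdeg c n"
  using keys_add[of m n]
  by (simp add: vdeg_superset[of "Poly_Mapping.keys m \<union> Poly_Mapping.keys n"] lookup_add
      single_add sum.distrib)

lemma vdeg_single: "vdeg c (Poly_Mapping.single e n) = (\<Sum>v\<in>e. Poly_Mapping.single (c v) n)"
  by (simp add: vdeg_def)

lemma lookup_deg:
  assumes "finite E" "Poly_Mapping.keys m \<subseteq> E" "\<And>e. e \<in> E \<Longrightarrow> finite e"
  shows "Poly_Mapping.lookup (deg m) v = (\<Sum>e\<in>E. if v \<in> e then Poly_Mapping.lookup m e else 0)"
  unfolding vdeg_superset[OF assms(1,2)]
  by (auto simp: lookup_sum lookup_single when_def sum.delta' assms(3) intro!: sum.cong)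

lemma lookup_vdeg_inj:
  assumes "inj_on c V" "\<And>e. e \<in> Poly_Mapping.keys m \<Longrightarrow> e \<subseteq> V" "v \<in> V"
  shows "Poly_Mapping.lookup (vdeg c m) (c v) = Poly_Mapping.lookup (deg m) v"
  unfolding vdeg_def lookup_sum lookup_single when_def
proof (intro sum.cong refl)
  fix e w assume "e \<in> Poly_Mapping.keys m" "w \<in> e"
  then have "w \<in> V" using assms(2) by blast
  then show "(if c w = c v then Poly_Mapping.lookup m e else 0) = (if w = v then Poly_Mapping.lookup m e else 0)"
    using assms(1,3) by (auto dest: inj_onD)
qed

lemma keys_vdeg: "Poly_Mapping.keys (vdeg c m) \<subseteq> c ` \<Union>(Poly_Mapping.keys m)"
proof
  fix w assume "w \<in> Poly_Mapping.keys (vdeg c m)"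
  then have "(\<Sum>e\<in>Poly_Mapping.keys m. \<Sum>v\<in>e. (Poly_Mapping.lookup m e when c v = w)) \<noteq> 0"
    by (simp add: in_keys_iff vdeg_def lookup_sum lookup_single)
  then obtain e where e: "e \<in> Poly_Mapping.keys m" "(\<Sum>v\<in>e. (Poly_Mapping.lookup m e when c v = w)) \<noteq> 0"
    by (meson sum.not_neutral_contains_not_neutral)
  then obtain v where "v \<in> e" "(Poly_Mapping.lookup m e when c v = w) \<noteq> 0"
    by (meson sum.not_neutral_contains_not_neutral)
  then have "v \<in> e" "w = c v" by (auto simp: when_def split: if_splits)
  with e show "w \<in> c ` \<Union>(Poly_Mapping.keys m)" by blast
qed

lemma keys_vdeg_subset:
  assumes "\<And>e. e \<in> Poly_Mapping.keys m \<Longrightarrow> e \<subseteq> V"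
  shows "Poly_Mapping.keys (vdeg c m) \<subseteq> c ` V"
proof -
  have "\<Union>(Poly_Mapping.keys m) \<subseteq> V" using assms by (rule Union_least)
  then show ?thesis using keys_vdeg[of c m] by (meson image_mono subset_trans)
qed

lemma vdeg_eq_iff:
  assumes "inj_on c V" "\<And>e. e \<in> Poly_Mapping.keys m \<Longrightarrow> e \<subseteq> V" "\<And>e. e \<in> Poly_Mapping.keys n \<Longrightarrow> e \<subseteq> V"
  shows "vdeg c m = vdeg c n \<longleftrightarrow> deg m = deg n"
proof
  assume eq: "vdeg c m = vdeg c n"
  show "deg m = deg n"
  proof (rule poly_mapping_eqI)
    fix v
    show "Poly_Mapping.lookup (deg m) v = Poly_Mapping.lookup (deg n) v"
    proof (cases "v \<in> V")
      case True
      then show ?thesis using eq lookup_vdeg_inj[OF assms(1,2)] lookup_vdeg_inj[OF assms(1,3)] by metis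
    next
      case False
      then have "v \<notin> Poly_Mapping.keys (deg m)" "v \<notin> Poly_Mapping.keys (deg n)"
        using keys_vdeg_subset[of m V "\<lambda>v. v", OF assms(2)] keys_vdeg_subset[of n V "\<lambda>v. v", OF assms(3)]
        by auto
      then show ?thesis by (simp add: in_keys_iff)
    qed
  qed
next
  assume eq: "deg m = deg n"
  show "vdeg c m = vdeg c n"
  proof (rule poly_mapping_eqI)
    fix w
    show "Poly_Mapping.lookup (vdeg c m) w = Poly_Mapping.lookup (vdeg c n) w"
    proof (cases "w \<in> c ` V")
      case True
      then show ?thesis using eq lookup_vdeg_inj[OF assms(1,2)] lookup_vdeg_inj[OF assms(1,3)] by auto
    next
      case False
      then have "w \<notin> Poly_Mapping.keys (vdeg c m)" "w \<notin> Poly_Mapping.keys (vdeg c n)"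
        using keys_vdeg_subset[of m V c, OF assms(2)] keys_vdeg_subset[of n V c, OF assms(3)]
        by auto
      then show ?thesis by (simp add: in_keys_iff)
    qed
  qed
qed

text \<open>The linear map of monoid algebras induced by \<open>h\<close>, an algebra homomorphism if \<open>h\<close> is additive.\<close>
definition push :: "('m \<Rightarrow> 'n) \<Rightarrow> ('m \<Rightarrow>\<^sub>0 'k::field) \<Rightarrow> 'n \<Rightarrow>\<^sub>0 'k" where
  "push h p = (\<Sum>m\<in>Poly_Mapping.keys p. Poly_Mapping.single (h m) (Poly_Mapping.lookup p m))"

lemma push_single [simp]: "push h (Poly_Mapping.single m c) = Poly_Mapping.single (h m) c"
  by (simp add: push_def)

lemma push_zero [simp]: "push h 0 = 0"
  by (simp add: push_def)

lemma lookup_push: "Poly_Mapping.lookup (push h p) d = lsum (\<lambda>m. if h m = d then 1 else 0) p"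
  by (auto simp: push_def lsum_def lookup_sum lookup_single when_def intro!: sum.cong)

lemma push_add: "push h (p + q) = push h p + push h q"
  by (rule poly_mapping_eqI) (simp add: lookup_push lookup_add lsum_add)

lemma push_mult:
  assumes "\<And>m n. h (m + n) = h m + h n"
  shows "push h (p * q) = push h p * push h q"
proof (induction p rule: poly_induct)
  case zero then show ?case by simp
next
  case (add a b) then show ?case by (simp add: push_add distrib_right)
next
  case (single m)
  show ?case
  proof (induction q rule: poly_induct)
    case zero then show ?case by simp
  next
    case (add a b) then show ?case by (simp add: push_add distrib_left)
  next
    case (single n)
    then show ?case by (simp add: mult_single assms)
  qed
qed

lemma prod_monomial:
  "(\<Prod>i\<in>I. monomial (a i)) = (monomial (\<Sum>i\<in>I. a i) :: 'm::comm_monoid_add \<Rightarrow>\<^sub>0 'k::field)"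
  by (induction I rule: infinite_finite_induct) (auto simp: mult_single)

lemma var_power: "var x ^ n = Poly_Mapping.single (Poly_Mapping.single x n) 1"
  by (induction n) (auto simp: var_def mult_single single_add[symmetric])

lemma poly_subst_edges: "poly_subst (\<lambda>e. \<Prod>v\<in>e. var v) p = push deg p"
  unfolding poly_subst_def push_def const_def vdeg_def
  by (intro sum.cong refl)
    (simp add: prod_power_distrib var_power prod_monomial mult_single)

lemma toric_ideal_eq:
  "toric_ideal V E = {p. indets p \<subseteq> E \<and> push deg p = 0}"
  by (auto simp: toric_ideal_def a_kernel_def' poly_subst_edges poly_ring_def)

lemma toric_ideal_indets: "p \<in> toric_ideal V E \<Longrightarrow> indets p \<subseteq> E"
  by (simp add: toric_ideal_eq)

lemma ideal_toric: "ideal (toric_ideal V E) (poly_ring E)"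
  unfolding toric_ideal_eq
  by (rule ideal_poly_ringI)
    (simp_all add: indets_zero push_add push_mult vdeg_add indets_mult_subset indets_add_subset)

lemmas toric_add = ideal_poly_ringD(3)[OF ideal_toric]
lemmas toric_mult = ideal_poly_ringD(4)[OF ideal_toric]

text \<open>After the vertices are numbered, the toric ideal is the kernel of a homomorphism into a polynomial ring
  over a linearly ordered set of variables, which is an integral domain.\<close>
lemma primeideal_toric:
  assumes "finite V" "\<And>e. e \<in> E \<Longrightarrow> e \<subseteq> V"
  shows "primeideal (toric_ideal V E :: ('v set, 'k::field) mpoly set) (poly_ring E)"
proof -
  obtain c :: "'v \<Rightarrow> nat" where c: "inj_on c V"
    using finite_imp_inj_to_nat_seg[OF assms(1)] by metis
  have eq: "push deg p = 0 \<longleftrightarrow> push (vdeg c) p = 0" if p: "indets p \<subseteq> E" for p :: "('v set, 'k) mpoly"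
  proof -
    have sub: "e \<subseteq> V" if "m \<in> Poly_Mapping.keys p" "e \<in> Poly_Mapping.keys m" for m e
      using p that assms(2) by (auto simp: indets_def)
    have same: "lsum (\<lambda>n. if vdeg c n = vdeg c m then 1 else 0) p
        = lsum (\<lambda>n. if deg n = deg m then 1 else 0) p" if "m \<in> Poly_Mapping.keys p" for m
      unfolding lsum_def using vdeg_eq_iff[OF c] sub that by (intro sum.cong) auto
    have fib: "push h p = 0 \<longleftrightarrow> (\<forall>m\<in>Poly_Mapping.keys p. lsum (\<lambda>n. if h n = h m then 1 else 0) p = 0)"
      for h :: "('v set \<Rightarrow>\<^sub>0 nat) \<Rightarrow> 'w"
    proof
      assume "push h p = 0"
      then show "\<forall>m\<in>Poly_Mapping.keys p. lsum (\<lambda>n. if h n = h m then 1 else 0) p = 0"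
        unfolding lookup_push[symmetric] by simp
    next
      assume *: "\<forall>m\<in>Poly_Mapping.keys p. lsum (\<lambda>n. if h n = h m then 1 else 0) p = 0"
      show "push h p = 0"
      proof (rule poly_mapping_eqI)
        fix d
        have "lsum (\<lambda>n. if h n = d then 1 else 0) p = 0"
        proof (cases "\<exists>m\<in>Poly_Mapping.keys p. h m = d")
          case False then show ?thesis unfolding lsum_def by (intro sum.neutral) auto
        qed (use * in auto)
        then show "Poly_Mapping.lookup (push h p) d = Poly_Mapping.lookup 0 d" by (simp add: lookup_push)
      qed
    qed
    show ?thesis unfolding fib using same by simp
  qed
  show ?thesis
  proof (rule primeidealI[OF ideal_toric poly_ring_cring])
    have "push deg (1 :: ('v set, 'k) mpoly) \<noteq> 0"
      using push_single[of deg 0 1] by (metis single_one vdeg_zero zero_neq_one)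
    then have "(1 :: ('v set, 'k) mpoly) \<notin> toric_ideal V E" by (simp add: toric_ideal_eq)
    moreover have "1 \<in> carrier (poly_ring E :: ('v set, 'k) mpoly ring)"
      by (simp add: poly_ring_def indets_one)
    ultimately show "carrier (poly_ring E) \<noteq> (toric_ideal V E :: ('v set, 'k) mpoly set)" by metis
    fix p q :: "('v set, 'k) mpoly"
    assume "p \<in> carrier (poly_ring E)" "q \<in> carrier (poly_ring E)" "p \<otimes>\<^bsub>poly_ring E\<^esub> q \<in> toric_ideal V E"
    then have i: "indets p \<subseteq> E" "indets q \<subseteq> E" and "indets (p * q) \<subseteq> E" "push deg (p * q) = 0"
      by (auto simp: poly_ring_def toric_ideal_eq)
    then have "push (vdeg c) (p * q) = 0" using eq by blast
    then have "push (vdeg c) p = 0 \<or> push (vdeg c) q = 0"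
      by (simp add: push_mult vdeg_add)
    then show "p \<in> toric_ideal V E \<or> q \<in> toric_ideal V E"
      using eq i by (simp add: toric_ideal_eq)
  qed
qed

definition binom :: "('m \<times> 'm) \<Rightarrow> 'm \<Rightarrow>\<^sub>0 'k::field" where
  "binom ab = monomial (fst ab) - monomial (snd ab)"

lemma push_diff: "push h (p - q) = push h p - push h q"
  by (rule poly_mapping_eqI) (simp add: lookup_push lookup_minus lsum_diff)

lemma binom_in_toric:
  assumes "Poly_Mapping.keys a \<subseteq> E" "Poly_Mapping.keys b \<subseteq> E" "deg a = deg b"
  shows "(binom (a, b) :: ('v set, 'k::field) mpoly) \<in> toric_ideal V E"
proof -
  have "indets (monomial a :: ('v set, 'k) mpoly) \<subseteq> E"
    "indets (monomial b :: ('v set, 'k) mpoly) \<subseteq> E"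
    using assms(1,2) by (auto simp: indets_def split: if_splits)
  then show ?thesis
    using assms(3) by (simp add: toric_ideal_eq binom_def push_diff indets_diff_subset)
qed

text \<open>A term of an element of the toric ideal always has a partner of equal degree, since the coefficients of
  that degree sum to zero. Subtracting a multiple of their binomial removes the term and creates no new
  one. The conclusion records that only binomials of terms of \<open>p\<close> are used.\<close>
lemma toric_binomial_induct:
  assumes "p \<in> toric_ideal V E"
    and "ideal J (poly_ring E)"
    and base: "\<And>a b. a \<in> Poly_Mapping.keys p \<Longrightarrow> b \<in> Poly_Mapping.keys p \<Longrightarrow> deg a = deg b \<Longrightarrow> a \<noteq> b \<Longrightarrow>
       binom (a, b) \<in> J"
  shows "p \<in> J"
  using assms(1,3)
proof (induction "card (Poly_Mapping.keys p)" arbitrary: p rule: less_induct)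
  case less
  note J = ideal_poly_ringD[OF assms(2)]
  show ?case
  proof (cases "p = 0")
    case True then show ?thesis using J(2) by simp
  next
    case False
    then obtain a where a: "a \<in> Poly_Mapping.keys p"
      by (metis all_not_in_conv keys_zero poly_expand sum.empty)
    have ind: "indets p \<subseteq> E" using less.prems(1) by (rule toric_ideal_indets)
    have "\<exists>b\<in>Poly_Mapping.keys p. b \<noteq> a \<and> deg b = deg a"
    proof (rule ccontr)
      assume *: "\<not> ?thesis"
      have "lsum (\<lambda>m. if deg m = deg a then 1 else 0) p = (\<Sum>m\<in>Poly_Mapping.keys p. if m = a then Poly_Mapping.lookup p m else 0)"
        unfolding lsum_def using * by (intro sum.cong) auto
      also have "\<dots> = Poly_Mapping.lookup p a" using a by (simp add: sum.delta)
      finally have "Poly_Mapping.lookup (push deg p) (deg a) = Poly_Mapping.lookup p a"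
        by (simp add: lookup_push)
      then show False using a less.prems(1) by (simp add: toric_ideal_eq in_keys_iff)
    qed
    then obtain b where b: "b \<in> Poly_Mapping.keys p" "b \<noteq> a" "deg b = deg a" by blast
    define c where "c = Poly_Mapping.lookup p a"
    define q where "q = p - const c * binom (a, b)"
    have eq: "const c * binom (a, b) = Poly_Mapping.single a c - Poly_Mapping.single b c"
      by (simp add: const_def binom_def right_diff_distrib mult_single)
    have cE: "indets (const x :: ('a set, 'b) mpoly) \<subseteq> E" for x by (simp add: const_def indets_def)
    have abE: "Poly_Mapping.keys a \<subseteq> E" "Poly_Mapping.keys b \<subseteq> E" using ind a b by (auto simp: indets_def)
    have bin: "binom (a, b) \<in> toric_ideal V E" using abE b(3) by (intro binom_in_toric) auto
    have "q = p + const (- c) * binom (a, b)"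
      by (simp add: q_def const_def single_uminus)
    then have qT: "q \<in> toric_ideal V E"
      using toric_add[OF less.prems(1) toric_mult[OF bin cE]] by metis
    have la: "a \<notin> Poly_Mapping.keys q"
      using b(2) unfolding in_keys_iff q_def eq
      by (simp add: lookup_minus lookup_single c_def)
    have "Poly_Mapping.keys q \<subseteq> Poly_Mapping.keys p"
      using a b unfolding q_def eq
      by (auto simp: in_keys_iff lookup_minus lookup_single when_def split: if_splits)
    with la a have sub: "Poly_Mapping.keys q \<subset> Poly_Mapping.keys p" by blast
    have "q \<in> J"
    proof (rule less.hyps[OF _ qT])
      show "card (Poly_Mapping.keys q) < card (Poly_Mapping.keys p)" using sub by (simp add: psubset_card_mono)
    qed (use sub less.prems(2) in auto)
    moreover have "const c * binom (a, b) \<in> J"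
      using less.prems(2)[OF a b(1)] b cE by (intro J(4)) auto
    ultimately have "q + const c * binom (a, b) \<in> J" by (rule J(3))
    then show ?thesis by (simp add: q_def)
  qed
qed

section \<open>An upper bound for the height\<close>

definition exp_bounded :: "nat \<Rightarrow> ('x, 'k::zero) mpoly \<Rightarrow> bool" where
  "exp_bounded D p \<longleftrightarrow> (\<forall>m\<in>Poly_Mapping.keys p. \<forall>x. Poly_Mapping.lookup m x \<le> D)"

lemma exp_bounded_mono: "exp_bounded D p \<Longrightarrow> D \<le> D' \<Longrightarrow> exp_bounded D' p"
  by (meson exp_bounded_def le_trans)

lemma exp_bounded_mult:
  fixes p q :: "('x, 'k::field) mpoly"
  assumes "exp_bounded D p" "exp_bounded D' q"
  shows "exp_bounded (D + D') (p * q)"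
  unfolding exp_bounded_def
proof (intro ballI allI)
  fix m x assume "m \<in> Poly_Mapping.keys (p * q)"
  then obtain a b where ab: "m = a + b" "a \<in> Poly_Mapping.keys p" "b \<in> Poly_Mapping.keys q"
    using keys_mult[of p q] by blast
  then show "Poly_Mapping.lookup m x \<le> D + D'"
    using assms by (simp add: exp_bounded_def lookup_add add_mono)
qed

lemma exp_bounded_power:
  fixes p :: "('x, 'k::field) mpoly"
  shows "exp_bounded D p \<Longrightarrow> exp_bounded (n * D) (p ^ n)"
proof (induction n)
  case 0 then show ?case by (simp add: exp_bounded_def)
next
  case (Suc n) then show ?case using exp_bounded_mult[of D p "n * D" "p ^ n"] by simp
qed

lemma exp_bounded_exists: "\<exists>D. exp_bounded D (p :: ('x, 'k::zero) mpoly)"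
proof -
  define D where "D = (\<Sum>m\<in>Poly_Mapping.keys p. \<Sum>x\<in>Poly_Mapping.keys m. Poly_Mapping.lookup m x)"
  have "Poly_Mapping.lookup m x \<le> D" if m: "m \<in> Poly_Mapping.keys p" for m x
  proof (cases "x \<in> Poly_Mapping.keys m")
    case True
    then have "Poly_Mapping.lookup m x \<le> (\<Sum>x\<in>Poly_Mapping.keys m. Poly_Mapping.lookup m x)"
      by (intro member_le_sum) auto
    also have "\<dots> \<le> D" unfolding D_def using m by (intro member_le_sum) auto
    finally show ?thesis .
  qed (simp add: in_keys_iff)
  then show ?thesis by (auto simp: exp_bounded_def)
qed

lemma lookup_const_mult: "Poly_Mapping.lookup (const c * p) m = c * Poly_Mapping.lookup p m"
  unfolding const_def mult_map_scale_conv_mult[symmetric] by (simp add: map.rep_eq when_def)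

lemma indets_const: "indets (const c) = {}"
  by (simp add: indets_def const_def)

lemma indets_power:
  fixes p :: "('x, 'k::field) mpoly"
  shows "indets p \<subseteq> X \<Longrightarrow> indets (p ^ n) \<subseteq> X"
  by (induction n) (simp_all add: indets_one indets_mult_subset)

definition indep_mod :: "('x, 'k::field) mpoly set \<Rightarrow> 'i set \<Rightarrow> ('i \<Rightarrow> ('x, 'k) mpoly) \<Rightarrow> bool" where
  "indep_mod J I b \<longleftrightarrow> (\<forall>c. (\<Sum>i\<in>I. const (c i) * b i) \<in> J \<longrightarrow> (\<forall>i\<in>I. c i = 0))"

lemma indep_mod_reindex:
  assumes "bij_betw h K I" "indep_mod J I b"
  shows "indep_mod J K (b \<circ> h)"
  unfolding indep_mod_def
proof (intro allI impI)
  fix c assume c: "(\<Sum>k\<in>K. const (c k) * (b \<circ> h) k) \<in> J"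
  define g where "g = inv_into K h"
  have g: "g (h k) = k" if "k \<in> K" for k
    using assms(1) that by (simp add: g_def bij_betw_inv_into_left)
  have "(\<Sum>i\<in>I. const (c (g i)) * b i) = (\<Sum>k\<in>K. const (c (g (h k))) * b (h k))"
    by (rule sum.reindex_bij_betw[OF assms(1), symmetric])
  also have "\<dots> = (\<Sum>k\<in>K. const (c k) * (b \<circ> h) k)" using g by (intro sum.cong) auto
  finally have "\<forall>i\<in>I. c (g i) = 0" using assms(2) c unfolding indep_mod_def by metis
  then show "\<forall>k\<in>K. c k = 0" using g assms(1) by (metis bij_betwE)
qed

text \<open>This step replaces additivity of the transcendence degree along a chain of primes. Consider a relation
  modulo \<open>P\<close> as a polynomial in \<open>f\<close>. Its constant coefficient lies in \<open>Q\<close>, hence vanishes by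
  independence modulo \<open>Q\<close>; then \<open>f\<close> divides the relation and can be cancelled since \<open>P\<close> is prime.\<close>
lemma indep_mod_powers:
  assumes P: "primeideal P (poly_ring X)" and Q: "ideal Q (poly_ring X)" and "P \<subseteq> Q"
    and f: "f \<in> Q" "f \<notin> P" and b: "\<And>i. i \<in> I \<Longrightarrow> indets (b i) \<subseteq> X"
    and indep: "indep_mod Q I b"
  shows "indep_mod P (I \<times> {..<N}) (\<lambda>(i, j). b i * f ^ j)"
proof -
  note Pi = ideal_poly_ringD[OF primeideal.axioms(1)[OF P]]
  note Qi = ideal_poly_ringD[OF Q]
  have fX: "indets f \<subseteq> X" using f Qi(1) by blast
  have lin: "indets (\<Sum>i\<in>I. const (c i) * b i) \<subseteq> X" for c
    using b by (intro indets_sum indets_mult_subset) (auto simp: indets_const)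
  have pow: "indets (f ^ n) \<subseteq> X" for n
    using fX by (rule indets_power)
  have main: "\<forall>i\<in>I. \<forall>j<N. c i j = 0" if "(\<Sum>j<N. (\<Sum>i\<in>I. const (c i j) * b i) * f ^ j) \<in> P" for c
    using that
  proof (induction N arbitrary: c)
    case 0 then show ?case by simp
  next
    case (Suc N)
    let ?S = "\<lambda>j. \<Sum>i\<in>I. const (c i j) * b i"
    let ?T = "\<Sum>j<N. ?S (Suc j) * f ^ j"
    have TX: "indets ?T \<subseteq> X" by (rule indets_sum, rule indets_mult_subset[OF lin pow])
    have eq: "(\<Sum>j<Suc N. ?S j * f ^ j) = ?S 0 + f * ?T"
      unfolding sum.lessThan_Suc_shift by (simp add: sum_distrib_left mult_ac)
    then have inP: "?S 0 + f * ?T \<in> P" using Suc.prems by simp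
    have "- (?T) * f \<in> Q" using TX f(1) by (intro Qi(4)) (simp_all add: indets_uminus)
    then have "(?S 0 + f * ?T) + (- (?T) * f) \<in> Q"
      using Qi(3)[OF subsetD[OF \<open>P \<subseteq> Q\<close> inP]] by blast
    then have "?S 0 \<in> Q" by (simp add: mult.commute)
    then have c0: "\<forall>i\<in>I. c i 0 = 0" using indep[unfolded indep_mod_def, rule_format, of "\<lambda>i. c i 0"] by blast
    then have "?S 0 = 0" by (simp add: const_def)
    then have "f * ?T \<in> P" using inP by simp
    then have "?T \<in> P"
      using primeideal.I_prime[OF P, of f ?T] f(2) fX TX by (auto simp: poly_ring_def)
    from Suc.IH[OF this] have "\<forall>i\<in>I. \<forall>j<N. c i (Suc j) = 0" .
    with c0 show ?case by (metis less_Suc_eq_0_disj)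
  qed
  show ?thesis
    unfolding indep_mod_def
  proof (intro allI impI)
    fix c assume c: "(\<Sum>p\<in>I \<times> {..<N}. const (c p) * (case p of (i, j) \<Rightarrow> b i * f ^ j)) \<in> P"
    have "(\<Sum>p\<in>I \<times> {..<N}. const (c p) * (case p of (i, j) \<Rightarrow> b i * f ^ j))
        = (\<Sum>i\<in>I. \<Sum>j<N. const (c (i, j)) * (b i * f ^ j))"
      by (subst sum.cartesian_product) (auto intro!: sum.cong)
    also have "\<dots> = (\<Sum>j<N. (\<Sum>i\<in>I. const (c (i, j)) * b i) * f ^ j)"
      by (subst sum.swap) (simp add: sum_distrib_right mult.assoc)
    finally have "\<forall>i\<in>I. \<forall>j<N. c (i, j) = 0" using c main[of "\<lambda>i j. c (i, j)"] by simp
    then show "\<forall>p\<in>I \<times> {..<N}. c p = 0" by auto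
  qed
qed

definition exponent :: "'x set \<Rightarrow> ('x \<Rightarrow> nat) \<Rightarrow> ('x \<Rightarrow>\<^sub>0 nat)" where
  "exponent B h = (\<Sum>x\<in>B. Poly_Mapping.single x (h x))"

lemma lookup_exponent: "finite B \<Longrightarrow> Poly_Mapping.lookup (exponent B h) x = (if x \<in> B then h x else 0)"
  by (auto simp: exponent_def lookup_sum lookup_single when_def sum.delta')

lemma exponent_surj:
  assumes "finite B" "Poly_Mapping.keys m \<subseteq> B"
  shows "m = exponent B (restrict (Poly_Mapping.lookup m) B)"
  using assms by (intro poly_mapping_eqI) (auto simp: lookup_exponent in_keys_iff)

lemma indep_mod_monomials:
  assumes "finite B" and B: "\<And>p. indets p \<subseteq> B \<Longrightarrow> p \<in> J \<Longrightarrow> p = (0 :: ('x, 'k::field) mpoly)"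
  shows "indep_mod J (B \<rightarrow>\<^sub>E {..<N}) (\<lambda>h. monomial (exponent B h) :: ('x, 'k) mpoly)"
  unfolding indep_mod_def
proof (intro allI impI ballI)
  fix c :: "('x \<Rightarrow> nat) \<Rightarrow> 'k" and h
  let ?p = "\<Sum>h\<in>B \<rightarrow>\<^sub>E {..<N}. const (c h) * (monomial (exponent B h) :: ('x, 'k) mpoly)"
  assume J: "?p \<in> J" and h: "h \<in> B \<rightarrow>\<^sub>E {..<N}"
  have fin: "finite (B \<rightarrow>\<^sub>E {..<N})" using assms(1) by (intro finite_PiE) auto
  have "indets ?p \<subseteq> B"
  proof (intro indets_sum indets_mult_subset)
    fix h
    have "Poly_Mapping.keys (exponent B h) \<subseteq> B"
      using assms(1) by (auto simp: in_keys_iff lookup_exponent split: if_splits)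
    then show "indets (monomial (exponent B h) :: ('x, 'k) mpoly) \<subseteq> B"
      using indets_single by (rule subset_trans[rotated])
  qed (simp add: indets_const)
  then have "?p = 0" using J by (rule B)
  then have "0 = Poly_Mapping.lookup ?p (exponent B h)" by simp
  also have "\<dots> = (\<Sum>g\<in>B \<rightarrow>\<^sub>E {..<N}. if g = h then c g else 0)"
    unfolding lookup_sum
  proof (rule sum.cong)
    fix g assume g: "g \<in> B \<rightarrow>\<^sub>E {..<N}"
    have "exponent B g = exponent B h \<longleftrightarrow> g = h"
    proof
      assume "exponent B g = exponent B h"
      then have "g x = h x" if "x \<in> B" for x
        using lookup_exponent[OF assms(1)] that by metis
      then show "g = h" using g h by (intro PiE_ext) auto
    qed simp
    then show "Poly_Mapping.lookup (const (c g) * monomial (exponent B g)) (exponent B h) = (if g = h then c g else 0)"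
      by (simp add: lookup_const_mult lookup_single)
  qed simp
  also have "\<dots> = c h" using h fin by (simp add: sum.delta)
  finally show "c h = 0" by simp
qed

text \<open>The coefficient vectors are independent rows, with columns indexed by the monomials with exponents at
  most \<open>D\<close>.\<close>
lemma indep_mod_card_le:
  fixes b :: "'i \<Rightarrow> ('x, 'k::field) mpoly"
  assumes "finite X" "finite I" "0 \<in> J" "indep_mod J I b"
    and b: "\<And>i. i \<in> I \<Longrightarrow> indets (b i) \<subseteq> X" "\<And>i. i \<in> I \<Longrightarrow> exp_bounded D (b i)"
  shows "card I \<le> (D + 1) ^ card X"
proof -
  define K where "K = exponent X ` (X \<rightarrow>\<^sub>E {..D})"
  have fin: "finite (X \<rightarrow>\<^sub>E {..D})" using assms(1) by (intro finite_PiE) auto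
  have keysK: "m \<in> K" if "i \<in> I" "m \<in> Poly_Mapping.keys (b i)" for i m
  proof -
    have "Poly_Mapping.keys m \<subseteq> X" using b(1)[OF that(1)] that(2) by (auto simp: indets_def)
    then have "m = exponent X (restrict (Poly_Mapping.lookup m) X)" by (rule exponent_surj[OF assms(1)])
    moreover have "restrict (Poly_Mapping.lookup m) X \<in> X \<rightarrow>\<^sub>E {..D}"
      using b(2)[OF that(1)] that(2) by (auto simp: exp_bounded_def)
    ultimately show ?thesis unfolding K_def by blast
  qed
  have "card I \<le> card K"
  proof (rule independent_rows_le_columns)
    show "finite I" by fact
    show "finite K" using fin by (simp add: K_def)
    fix c assume c: "\<And>m. m \<in> K \<Longrightarrow> (\<Sum>i\<in>I. c i * Poly_Mapping.lookup (b i) m) = 0"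
    have "(\<Sum>i\<in>I. const (c i) * b i) = 0"
    proof (rule poly_mapping_eqI)
      fix m
      have "(\<Sum>i\<in>I. c i * Poly_Mapping.lookup (b i) m) = 0"
      proof (cases "m \<in> K")
        case False
        then have "Poly_Mapping.lookup (b i) m = 0" if "i \<in> I" for i
          using keysK[OF that] by (meson in_keys_iff)
        then show ?thesis by simp
      qed (rule c)
      then show "Poly_Mapping.lookup (\<Sum>i\<in>I. const (c i) * b i) m = Poly_Mapping.lookup 0 m"
        by (simp add: lookup_sum lookup_const_mult)
    qed
    then show "\<forall>i\<in>I. c i = 0" using assms(3,4) unfolding indep_mod_def by metis
  qed
  also have "\<dots> \<le> card (X \<rightarrow>\<^sub>E {..D})" unfolding K_def using fin by (rule card_image_le)
  also have "\<dots> = (D + 1) ^ card X" using assms(1) by (simp add: card_PiE)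
  finally show ?thesis .
qed

text \<open>Begin with the \<open>N ^ |B|\<close> monomials in \<open>B\<close> with exponents below \<open>N\<close>, which are independent modulo the
  top prime. Descending the chain, each step multiplies the independent family by \<open>N\<close> powers of an
  element of the difference of two consecutive primes. The exponents that occur stay below a constant
  times \<open>N\<close>, so at the bottom \<open>N ^ (|B| + l)\<close> is at most a constant times \<open>N ^ |X|\<close>. For large \<open>N\<close>
  this forces \<open>l + |B| \<le> |X|\<close>.\<close>
lemma prime_chain_length_le:
  fixes C :: "nat \<Rightarrow> ('x, 'k::field) mpoly set"
  assumes "finite X" "B \<subseteq> X"
    and prime: "\<And>i. i \<le> l \<Longrightarrow> primeideal (C i) (poly_ring X)"
    and chain: "\<And>i. i < l \<Longrightarrow> C i \<subset> C (Suc i)"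
    and B: "\<And>p. indets p \<subseteq> B \<Longrightarrow> p \<in> C l \<Longrightarrow> p = 0"
  shows "l + card B \<le> card X"
proof (rule ccontr)
  assume contr: "\<not> l + card B \<le> card X"
  have finB: "finite B" using assms(1,2) finite_subset by blast
  have "\<forall>i. \<exists>f. i < l \<longrightarrow> f \<in> C (Suc i) - C i" using chain by blast
  then obtain f where f: "\<And>i. i < l \<Longrightarrow> f i \<in> C (Suc i)" "\<And>i. i < l \<Longrightarrow> f i \<notin> C i" by (metis Diff_iff)
  have "\<forall>i. \<exists>D. exp_bounded D (f i)" using exp_bounded_exists by blast
  then obtain D' where D': "\<And>i. exp_bounded (D' i) (f i)" by metis
  define D where "D = (\<Sum>i<l. D' i)"
  have D: "exp_bounded D (f i)" if "i < l" for i
  proof (rule exp_bounded_mono[OF D'])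
    show "D' i \<le> D" unfolding D_def using that by (intro member_le_sum) auto
  qed
  have ideal: "ideal (C i) (poly_ring X)" if "i \<le> l" for i using prime[OF that] by (rule primeideal.axioms(1))
  \<comment> \<open>At most \<open>(l * D + 2) ^ card X * N ^ card X\<close> monomials are available; \<open>N\<close> exceeds the
    first factor.\<close>
  define N where "N = (l * D + 2) ^ card X + 1"
  have "\<exists>b :: nat \<Rightarrow> ('x, 'k) mpoly. (\<forall>i<N ^ (card B + j). indets (b i) \<subseteq> X \<and> exp_bounded (N + j * (N * D)) (b i))
       \<and> indep_mod (C (l - j)) {..<N ^ (card B + j)} b" if "j \<le> l" for j
    using that
  proof (induction j)
    case 0
    let ?I = "B \<rightarrow>\<^sub>E {..<N}" and ?b = "\<lambda>h. monomial (exponent B h) :: ('x, 'k) mpoly"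
    have fin: "finite ?I" using finB by (intro finite_PiE) auto
    have card: "card ?I = N ^ card B" using finB by (simp add: card_PiE)
    obtain h where h: "bij_betw h {..<N ^ card B} ?I"
      using ex_bij_betw_nat_finite[OF fin] card by (metis atLeast0LessThan)
    have "indep_mod (C l) ?I ?b" by (rule indep_mod_monomials[OF finB B])
    from indep_mod_reindex[OF h this] have "indep_mod (C l) {..<N ^ card B} (?b \<circ> h)" .
    moreover have "indets ((?b \<circ> h) i) \<subseteq> X \<and> exp_bounded N ((?b \<circ> h) i)" if "i < N ^ card B" for i
    proof
      have hi: "h i \<in> ?I" using h that by (auto simp: bij_betw_def)
      have "Poly_Mapping.keys (exponent B (h i)) \<subseteq> B"
        using finB by (auto simp: in_keys_iff lookup_exponent split: if_splits)
      then show "indets ((?b \<circ> h) i) \<subseteq> X"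
        using assms(2) by (auto simp: indets_def split: if_splits)
      have "h i x \<le> N" if "x \<in> B" for x using hi that by (auto simp: PiE_iff less_imp_le)
      then show "exp_bounded N ((?b \<circ> h) i)"
        by (auto simp: exp_bounded_def lookup_exponent finB)
    qed
    ultimately show ?case by (intro exI[of _ "?b \<circ> h"]) (simp only: add_0_right mult_0 diff_zero, blast)
  next
    case (Suc j)
    then obtain b :: "nat \<Rightarrow> ('x, 'k) mpoly"
      where b: "\<And>i. i < N ^ (card B + j) \<Longrightarrow> indets (b i) \<subseteq> X"
        "\<And>i. i < N ^ (card B + j) \<Longrightarrow> exp_bounded (N + j * (N * D)) (b i)"
        "indep_mod (C (l - j)) {..<N ^ (card B + j)} b"
      by auto
    define k where "k = l - Suc j"
    have k: "k < l" "Suc k = l - j" using Suc.prems by (auto simp: k_def)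
    let ?I = "{..<N ^ (card B + j)} \<times> {..<N}" and ?b = "\<lambda>(i, j). b i * f k ^ j"
    have ind: "indep_mod (C k) ?I ?b"
    proof (rule indep_mod_powers)
      show "primeideal (C k) (poly_ring X)" "ideal (C (Suc k)) (poly_ring X)"
        "C k \<subseteq> C (Suc k)" "f k \<in> C (Suc k)" "f k \<notin> C k"
        using prime[of k] ideal[of "Suc k"] chain[OF k(1)] f(1,2)[OF k(1)] k(1) by auto
      show "indep_mod (C (Suc k)) {..<N ^ (card B + j)} b" using b(3) k by simp
    qed (use b in auto)
    have card: "card ?I = N ^ (card B + Suc j)" by simp
    obtain h where h: "bij_betw h {..<N ^ (card B + Suc j)} ?I"
      using ex_bij_betw_nat_finite[of ?I] card by (metis atLeast0LessThan finite_cartesian_product finite_lessThan)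
    from indep_mod_reindex[OF h ind] have "indep_mod (C k) {..<N ^ (card B + Suc j)} (?b \<circ> h)" .
    moreover have "indets ((?b \<circ> h) i) \<subseteq> X \<and> exp_bounded (N + Suc j * (N * D)) ((?b \<circ> h) i)"
      if i: "i < N ^ (card B + Suc j)" for i
    proof -
      have "h i \<in> ?I" using bij_betwE[OF h] i by blast
      then obtain r s where rs: "h i = (r, s)" "r < N ^ (card B + j)" "s < N" by auto
      have fk: "indets (f k) \<subseteq> X" using ideal_poly_ringD(1)[OF ideal] f(1)[OF k(1)] k(1) by (metis Suc_leI)
      have "indets (f k ^ s) \<subseteq> X"
        using fk by (rule indets_power)
      then have "indets (b r * f k ^ s) \<subseteq> X" using b(1)[OF rs(2)] by (rule indets_mult_subset[rotated])
      moreover have "exp_bounded (N + j * (N * D) + s * D) (b r * f k ^ s)"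
        by (intro exp_bounded_mult exp_bounded_power b(2)[OF rs(2)] D k(1))
      then have "exp_bounded (N + Suc j * (N * D)) (b r * f k ^ s)"
        by (rule exp_bounded_mono) (use rs(3) in simp)
      ultimately show ?thesis by (simp add: rs(1))
    qed
    ultimately show ?case unfolding k_def[symmetric] by (intro exI[of _ "?b \<circ> h"]) blast
  qed
  from this[of l] obtain b :: "nat \<Rightarrow> ('x, 'k) mpoly"
    where b: "\<And>i. i < N ^ (card B + l) \<Longrightarrow> indets (b i) \<subseteq> X"
      "\<And>i. i < N ^ (card B + l) \<Longrightarrow> exp_bounded (N + l * (N * D)) (b i)"
      "indep_mod (C 0) {..<N ^ (card B + l)} b"
    by auto
  have N1: "1 \<le> N" by (simp add: N_def)
  have "N ^ (card X + 1) \<le> N ^ (card B + l)"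
    using contr N1 by (intro power_increasing) auto
  also have "\<dots> = card {..<N ^ (card B + l)}" by simp
  also have "\<dots> \<le> (N + l * (N * D) + 1) ^ card X"
    using b ideal_poly_ringD(2)[OF ideal[of 0]] assms(1) by (intro indep_mod_card_le[of _ _ "C 0"]) auto
  also have "\<dots> \<le> (N * (l * D + 2)) ^ card X"
    using N1 by (intro power_mono) (auto simp: algebra_simps)
  also have "\<dots> = N ^ card X * (N - 1)" by (simp only: power_mult_distrib) (simp add: N_def)
  also have "\<dots> < N ^ (card X + 1)" using N1 by simp
  finally show False by simp
qed

lemma deg_incidence:
  assumes "finite E" "Poly_Mapping.keys m \<subseteq> E" "\<And>e. e \<in> E \<Longrightarrow> finite e"
  shows "of_nat (Poly_Mapping.lookup (deg m) v) = (\<Sum>e\<in>E. of_nat (Poly_Mapping.lookup m e) * incidence e v)"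
  using assms by (subst lookup_deg[OF assms(1,2)]) (auto simp: incidence_def intro!: sum.cong)

text \<open>On a column basis \<open>B\<close> of the incidence matrix, distinct monomials have distinct degrees, so a polynomial
  in the variables from \<open>B\<close> lies in the toric ideal only if it vanishes. The toric ideal is itself prime,
  so that chains of primes ending in it bound its height.\<close>
lemma toric_height_le:
  assumes "simple_graph V E"
  obtains h where "ideal_height (poly_ring E) (toric_ideal V E :: ('v set, 'k::field) mpoly set) = enat h"
    "h + card V \<le> card E + num_bipartite_components V E"
proof -
  from incidence_basis[OF assms] obtain B where B: "B \<subseteq> E"
    "card B + num_bipartite_components V E = card V"
    "\<And>d. (\<And>v. (\<Sum>e\<in>B. d e * incidence e v) = 0) \<Longrightarrow> \<forall>e\<in>B. d e = 0"
    by metis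
  have finE: "finite E" by (rule finite_edges[OF assms])
  then have finB: "finite B" using B(1) finite_subset by blast
  have fe: "finite e" if "e \<in> E" for e
    using edge_obtain[OF assms that] by (metis finite.emptyI finite_insert)
  have feB: "finite e" if "e \<in> B" for e using fe B(1) that by blast
  have inj: "m = n" if "Poly_Mapping.keys m \<subseteq> B" "Poly_Mapping.keys n \<subseteq> B" "deg m = deg n" for m n
  proof (rule poly_mapping_eqI)
    fix e
    have "(\<Sum>e\<in>B. (of_nat (Poly_Mapping.lookup m e) - of_nat (Poly_Mapping.lookup n e)) * incidence e v) = 0" for v
      using deg_incidence[OF finB that(1) feB, of v] deg_incidence[OF finB that(2) feB, of v] that(3)
      by (simp add: left_diff_distrib sum_subtractf)
    from B(3)[OF this] have "Poly_Mapping.lookup m e = Poly_Mapping.lookup n e" if "e \<in> B" using that by auto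
    moreover have "Poly_Mapping.lookup m e = Poly_Mapping.lookup n e" if "e \<notin> B"
      using \<open>Poly_Mapping.keys m \<subseteq> B\<close> \<open>Poly_Mapping.keys n \<subseteq> B\<close> that by (metis in_keys_iff subsetD)
    ultimately show "Poly_Mapping.lookup m e = Poly_Mapping.lookup n e" by blast
  qed
  let ?T = "toric_ideal V E :: ('v set, 'k) mpoly set"
  have zero: "p = 0" if "indets p \<subseteq> B" "p \<in> ?T" for p
  proof (rule poly_mapping_eqI)
    fix m
    show "Poly_Mapping.lookup p m = Poly_Mapping.lookup 0 m"
    proof (cases "m \<in> Poly_Mapping.keys p")
      case True
      have keysB: "Poly_Mapping.keys n \<subseteq> B" if "n \<in> Poly_Mapping.keys p" for n
        using \<open>indets p \<subseteq> B\<close> that by (auto simp: indets_def)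
      have "0 = lsum (\<lambda>n. if deg n = deg m then 1 else 0) p"
        using that(2) by (simp add: toric_ideal_eq lookup_push[symmetric])
      also have "\<dots> = (\<Sum>n\<in>Poly_Mapping.keys p. if n = m then Poly_Mapping.lookup p n else 0)"
        unfolding lsum_def using inj keysB True by (intro sum.cong) auto
      also have "\<dots> = Poly_Mapping.lookup p m" using True by (simp add: sum.delta)
      finally show ?thesis by simp
    qed (simp add: in_keys_iff)
  qed
  have "ideal_height (poly_ring E) ?T \<le> prime_height (poly_ring E) ?T"
    unfolding ideal_height_def
  proof (rule Inf_lower)
    have "primeideal ?T (poly_ring E)"
      using assms by (intro primeideal_toric) (auto simp: simple_graph_def)
    then show "prime_height (poly_ring E) ?T \<in> {prime_height (poly_ring E) P |P. primeideal P (poly_ring E) \<and> ?T \<subseteq> P}"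
      by blast
  qed
  also have "\<dots> \<le> enat (card E - card B)"
    unfolding prime_height_def
  proof (rule Sup_least, clarify)
    fix l and C :: "nat \<Rightarrow> ('v set, 'k) mpoly set"
    assume C: "\<forall>i\<le>l. primeideal (C i) (poly_ring E)" "\<forall>i<l. C i \<subset> C (Suc i)" "C l = ?T"
    have "l + card B \<le> card E"
      using C zero by (intro prime_chain_length_le[OF finE B(1), of l C]) auto
    then show "enat l \<le> enat (card E - card B)" by simp
  qed
  finally have le: "ideal_height (poly_ring E) ?T \<le> enat (card E - card B)" .
  then obtain h where h: "ideal_height (poly_ring E) ?T = enat h" by (metis enat_ile)
  have "card B \<le> card E" using finE B(1) by (rule card_mono)
  then have "h + card V \<le> card E + num_bipartite_components V E" using le h B(2) by simp
  with h that show ?thesis by blast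
qed

section \<open>Smallest sets of binomial generators\<close>

lemma keys_add_nat: "Poly_Mapping.keys (m + n :: 'x \<Rightarrow>\<^sub>0 nat) = Poly_Mapping.keys m \<union> Poly_Mapping.keys n"
  by (auto simp: in_keys_iff lookup_add)

lemma split_single:
  fixes m :: "'x \<Rightarrow>\<^sub>0 nat"
  assumes "e \<in> Poly_Mapping.keys m"
  shows "m = Poly_Mapping.single e 1 + (m - Poly_Mapping.single e 1)"
  using assms
  by (intro poly_mapping_eqI) (auto simp: lookup_add lookup_minus lookup_single when_def in_keys_iff)

lemma lookup_const_zero: "Poly_Mapping.lookup (const c) 0 = c"
  by (simp add: const_def)

definition total :: "('x \<Rightarrow>\<^sub>0 nat) \<Rightarrow> nat" where
  "total m = (\<Sum>x\<in>Poly_Mapping.keys m. Poly_Mapping.lookup m x)"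

lemma total_zero [simp]: "total 0 = 0" by (simp add: total_def)

lemma total_single [simp]: "total (Poly_Mapping.single x n) = n" by (simp add: total_def)

lemma total_add: "total (m + n) = total m + total n"
proof -
  let ?K = "Poly_Mapping.keys m \<union> Poly_Mapping.keys n"
  have *: "total p = (\<Sum>x\<in>?K. Poly_Mapping.lookup p x)" if "Poly_Mapping.keys p \<subseteq> ?K" for p
    unfolding total_def using that by (intro sum.mono_neutral_left) (auto simp: in_keys_iff)
  show ?thesis by (simp add: * keys_add_nat lookup_add sum.distrib)
qed

lemma total_sum: "total (\<Sum>i\<in>I. f i) = (\<Sum>i\<in>I. total (f i))"
  by (induction I rule: infinite_finite_induct) (auto simp: total_add)

lemma card_keys_le_total: "card (Poly_Mapping.keys m) \<le> total m"
proof -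
  have "(\<Sum>x\<in>Poly_Mapping.keys m. 1) \<le> total m"
    unfolding total_def by (rule sum_mono) (simp add: in_keys_iff)
  then show ?thesis by simp
qed

lemma total_deg:
  assumes "\<And>e. e \<in> Poly_Mapping.keys m \<Longrightarrow> card e = 2"
  shows "total (deg m) = 2 * total m"
  using assms by (simp add: vdeg_def total_sum total_def[of m] sum_distrib_left)

lemma edge_subset_keys_deg:
  assumes "e \<in> Poly_Mapping.keys m" "\<And>e. e \<in> Poly_Mapping.keys m \<Longrightarrow> finite e"
  shows "e \<subseteq> Poly_Mapping.keys (deg m)"
proof
  fix v assume v: "v \<in> e"
  have "Poly_Mapping.lookup m e \<le> Poly_Mapping.lookup (deg m) v"
    using assms v member_le_sum[of e "Poly_Mapping.keys m" "\<lambda>e. if v \<in> e then Poly_Mapping.lookup m e else 0"]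
    by (subst lookup_deg[of "Poly_Mapping.keys m"]) auto
  then show "v \<in> Poly_Mapping.keys (deg m)" using assms(1) by (auto simp: in_keys_iff)
qed

lemma deg_eq_zero:
  assumes "\<And>e. e \<in> Poly_Mapping.keys m \<Longrightarrow> card e = 2" "deg m = 0"
  shows "m = 0"
proof -
  have "total (deg m) = 2 * total m" using assms(1) by (rule total_deg)
  then have "total m = 0" using assms(2) by simp
  then show ?thesis by (intro poly_mapping_eqI) (auto simp: total_def in_keys_iff)
qed

text \<open>For monomials supported on a vertex set \<open>W\<close>, the edges at a vertex \<open>x\<close> can be indexed by their other
  end, as in the complete graph on \<open>W\<close>; pairs that are not edges have exponent zero.\<close>
lemma lookup_deg_complete:
  assumes "finite W" "x \<in> W" "\<And>e. e \<in> Poly_Mapping.keys m \<Longrightarrow> card e = 2 \<and> e \<subseteq> W"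
  shows "Poly_Mapping.lookup (deg m) x = (\<Sum>w\<in>W - {x}. Poly_Mapping.lookup m {x, w})"
proof -
  have fin: "finite e" if "e \<in> Poly_Mapping.keys m" for e
    using assms(3)[OF that] by (metis card.infinite zero_neq_numeral)
  have "Poly_Mapping.lookup (deg m) x = (\<Sum>e\<in>Poly_Mapping.keys m. if x \<in> e then Poly_Mapping.lookup m e else 0)"
    using fin by (intro lookup_deg) auto
  also have "\<dots> = (\<Sum>e\<in>{e \<in> Poly_Mapping.keys m. x \<in> e}. Poly_Mapping.lookup m e)"
    by (rule sum.inter_filter[symmetric]) simp
  also have "\<dots> = (\<Sum>e\<in>(\<lambda>w. {x, w}) ` (W - {x}). Poly_Mapping.lookup m e)"
  proof (rule sum.mono_neutral_left)
    show "finite ((\<lambda>w. {x, w}) ` (W - {x}))" using assms(1) by simp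
    show "{e \<in> Poly_Mapping.keys m. x \<in> e} \<subseteq> (\<lambda>w. {x, w}) ` (W - {x})"
    proof
      fix e assume e: "e \<in> {e \<in> Poly_Mapping.keys m. x \<in> e}"
      then have "card e = 2" "e \<subseteq> W" "x \<in> e" using assms(3) by auto
      then obtain w where "e = {x, w}" "x \<noteq> w" unfolding card_2_iff by auto
      with \<open>e \<subseteq> W\<close> show "e \<in> (\<lambda>w. {x, w}) ` (W - {x})" by auto
    qed
  qed (auto simp: in_keys_iff)
  also have "\<dots> = (\<Sum>w\<in>W - {x}. Poly_Mapping.lookup m {x, w})"
    by (subst sum.reindex) (auto simp: inj_on_def doubleton_eq_iff)
  finally show ?thesis .
qed

lemma deg_pair: "p \<noteq> q \<Longrightarrow> deg (Poly_Mapping.single {p, q} n) = Poly_Mapping.single p n + Poly_Mapping.single q n"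
  by (simp add: vdeg_single)

definition exponent_diff :: "('x \<Rightarrow>\<^sub>0 nat) \<times> ('x \<Rightarrow>\<^sub>0 nat) \<Rightarrow> 'x \<Rightarrow> rat" where
  "exponent_diff ab e = of_nat (Poly_Mapping.lookup (fst ab) e) - of_nat (Poly_Mapping.lookup (snd ab) e)"

lemma span_family:
  assumes "finite I" "x \<in> fun_space.span (u ` I)"
  obtains c where "\<And>e. x e = (\<Sum>i\<in>I. c i * u i e)"
proof -
  have "fun_space.span (u ` I) \<subseteq> {x. \<exists>c. \<forall>e. x e = (\<Sum>i\<in>I. c i * u i e)}"
  proof (rule fun_space.span_minimal)
    show "u ` I \<subseteq> {x. \<exists>c. \<forall>e. x e = (\<Sum>i\<in>I. c i * u i e)}"
    proof safe
      fix i assume "i \<in> I"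
      then have "u i e = (\<Sum>j\<in>I. (if j = i then 1 else 0) * u j e)" for e
        using assms(1) by (simp add: if_distrib[of "\<lambda>x. x * _"] sum.delta cong: if_cong)
      then show "\<exists>c. \<forall>e. u i e = (\<Sum>j\<in>I. c j * u j e)"
        by (intro exI[of _ "\<lambda>j. if j = i then 1 else 0"] allI)
    qed
    show "fun_space.subspace {x. \<exists>c. \<forall>e. x e = (\<Sum>i\<in>I. c i * u i e)}"
    proof (rule fun_space.subspaceI)
      show "0 \<in> {x. \<exists>c. \<forall>e. x e = (\<Sum>i\<in>I. c i * u i e)}"
        by (auto intro: exI[of _ "\<lambda>_. 0"])
    next
      fix x y assume "x \<in> {x. \<exists>c. \<forall>e. x e = (\<Sum>i\<in>I. c i * u i e)}" "y \<in> {x. \<exists>c. \<forall>e. x e = (\<Sum>i\<in>I. c i * u i e)}"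
      then obtain c d where "\<And>e. x e = (\<Sum>i\<in>I. c i * u i e)" "\<And>e. y e = (\<Sum>i\<in>I. d i * u i e)" by blast
      then have "(x + y) e = (\<Sum>i\<in>I. (c i + d i) * u i e)" for e by (simp add: distrib_right sum.distrib)
      then show "x + y \<in> {x. \<exists>c. \<forall>e. x e = (\<Sum>i\<in>I. c i * u i e)}" by (intro CollectI exI allI)
    next
      fix s x assume "x \<in> {x. \<exists>c. \<forall>e. x e = (\<Sum>i\<in>I. c i * u i e)}"
      then obtain c where "\<And>e. x e = (\<Sum>i\<in>I. c i * u i e)" by blast
      then have "fscale s x e = (\<Sum>i\<in>I. (s * c i) * u i e)" for e
        by (simp add: fscale_apply sum_distrib_left mult.assoc)
      then show "fscale s x \<in> {x. \<exists>c. \<forall>e. x e = (\<Sum>i\<in>I. c i * u i e)}" by (intro CollectI exI allI)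
    qed
  qed
  with assms(2) that show ?thesis by blast
qed

lemma clear_denominators:
  fixes w :: "'x \<Rightarrow> rat"
  assumes "finite F"
  shows "\<exists>N::nat. N > 0 \<and> (\<forall>e\<in>F. \<exists>z::int. of_nat N * w e = of_int z)"
  using assms
proof induction
  case empty then show ?case by (intro exI[of _ 1]) auto
next
  case (insert e F)
  then obtain N :: nat where N: "N > 0" "\<forall>e\<in>F. \<exists>z::int. of_nat N * w e = of_int z" by auto
  obtain a b where ab: "w e = Fract a b" "b > 0" by (cases "w e")
  define M where "M = N * nat b"
  have M: "of_nat M = (of_nat N * of_int b :: rat)" using ab(2) by (simp add: M_def)
  have "\<exists>z::int. of_nat M * w f = of_int z" if "f \<in> insert e F" for f
  proof (cases "f = e")
    case True
    have "of_nat M * w f = of_int (int N * a)"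
      using ab(2) unfolding True M ab(1) Fract_of_int_quotient by simp
    then show ?thesis by blast
  next
    case False
    then have "f \<in> F" using that by blast
    then obtain z :: int where "of_nat N * w f = of_int z" using N(2) by blast
    then have "of_nat M * w f = of_int (b * z)" unfolding M by (simp add: mult_ac)
    then show ?thesis by blast
  qed
  moreover have "M > 0" using N(1) ab(2) by (simp add: M_def)
  ultimately show ?case by blast
qed

text \<open>Minimality only excludes the omission of a single member: since the grading by vertex degree is positive,
  this already yields the conclusions of Nakayama's lemma.\<close>
locale toric_binomials =
  fixes V :: "'v set" and E :: "'v set set"
    and I :: "(('v set \<Rightarrow>\<^sub>0 nat) \<times> ('v set \<Rightarrow>\<^sub>0 nat)) set"
    and T :: "('v set, 'k::field) mpoly set"
  assumes graph: "simple_graph V E"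
    and T: "T = toric_ideal V E"
    and finite_I: "finite I"
    and binomial: "\<And>a b. (a, b) \<in> I \<Longrightarrow>
      Poly_Mapping.keys a \<subseteq> E \<and> Poly_Mapping.keys b \<subseteq> E \<and> a \<noteq> b \<and> deg a = deg b"
    and generates: "lin_comb E I binom = T"
    and minimal: "\<And>i. i \<in> I \<Longrightarrow> lin_comb E (I - {i}) binom \<noteq> T"
begin

lemma edge_card: "e \<in> E \<Longrightarrow> card e = 2" and edge_finite: "e \<in> E \<Longrightarrow> finite e"
  and edge_subset: "e \<in> E \<Longrightarrow> e \<subseteq> V" and finite_E: "finite E" and finite_V: "finite V"
  using graph finite_edges[OF graph] finite_subset by (auto simp: simple_graph_def)

lemma ideal_T: "ideal T (poly_ring E)"
  unfolding T by (rule ideal_toric)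

lemma binom_T: "i \<in> I \<Longrightarrow> (binom i :: ('v set, 'k) mpoly) \<in> T"
  using generates lin_comb_base[OF finite_I] by blast

lemma indets_binom: "i \<in> I \<Longrightarrow> indets (binom i :: ('v set, 'k) mpoly) \<subseteq> E"
  by (rule ideal_poly_ringD(1)[OF ideal_T binom_T])

lemma binom_deg:
  assumes "i \<in> I" "m \<in> Poly_Mapping.keys (binom i :: ('v set, 'k) mpoly)"
  shows "deg m = deg (fst i)"
proof -
  have "m = fst i \<or> m = snd i"
    using assms(2) by (auto simp: binom_def in_keys_iff lookup_minus lookup_single when_def split: if_splits)
  then show ?thesis using assms(1) binomial[of "fst i" "snd i"] by auto
qed

lemma filt_combination:
  fixes g :: "_ \<Rightarrow> ('v set, 'k) mpoly"
  assumes "J \<subseteq> I"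
  shows "filt (\<lambda>m. Q (deg m)) (\<Sum>i\<in>J. g i * binom i)
    = (\<Sum>i\<in>J. filt (\<lambda>m. Q (deg m + deg (fst i))) (g i) * binom i)"
  unfolding filt_sum
proof (rule sum.cong[OF refl])
  fix i assume "i \<in> J"
  then have "i \<in> I" using assms by blast
  then show "filt (\<lambda>m. Q (deg m)) (g i * binom i) = filt (\<lambda>m. Q (deg m + deg (fst i))) (g i) * binom i"
    by (intro filt_mult_homogeneous vdeg_add binom_deg)
qed

text \<open>If a coefficient \<open>g i\<close> had a nonzero constant term, then the component of the syzygy in the degree of the
  \<open>i\<close>-th binomial would express this binomial by the others: in that component the coefficient of the
  \<open>i\<close>-th binomial has degree zero, and only the monomial \<open>1\<close> has degree zero.\<close>
lemma syzygy_constant_term: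
  fixes g :: "_ \<Rightarrow> ('v set, 'k) mpoly"
  assumes g: "\<And>i. indets (g i) \<subseteq> E" and zero: "(\<Sum>i\<in>I. g i * binom i) = 0" and i: "i \<in> I"
  shows "Poly_Mapping.lookup (g i) 0 = 0"
proof (rule ccontr)
  define c where "c = Poly_Mapping.lookup (g i) 0"
  assume "Poly_Mapping.lookup (g i) 0 \<noteq> 0"
  then have c: "c \<noteq> 0" by (simp add: c_def)
  define h where "h j = filt (\<lambda>m. deg m + deg (fst j) = deg (fst i)) (g j)" for j
  have hE: "indets (h j) \<subseteq> E" for j using g indets_filt unfolding h_def by (rule subset_trans[rotated])
  have "(\<Sum>j\<in>I. h j * binom j) = filt (\<lambda>m. deg m = deg (fst i)) (\<Sum>j\<in>I. g j * binom j)"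
    unfolding h_def by (rule filt_combination[symmetric, where Q = "\<lambda>d. d = deg (fst i)"]) simp
  then have sum0: "(\<Sum>j\<in>I. h j * binom j) = 0" unfolding zero by simp
  have hi: "h i = const c"
  proof (rule poly_mapping_eqI)
    fix m
    have "m = 0" if "m \<in> Poly_Mapping.keys (g i)" "deg m = 0"
      using that g[of i] edge_card by (intro deg_eq_zero) (auto simp: indets_def)
    then show "Poly_Mapping.lookup (h i) m = Poly_Mapping.lookup (const c) m"
      by (auto simp: h_def lookup_filt const_def lookup_single when_def c_def in_keys_iff)
  qed
  have "const c * binom i + (\<Sum>j\<in>I - {i}. h j * binom j) = 0"
    using sum0 i finite_I by (simp add: sum.remove hi)
  then have "const c * binom i = - (\<Sum>j\<in>I - {i}. h j * binom j)" by (rule eq_neg_iff_add_eq_0[THEN iffD2])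
  then have "const (- inverse c) * (const c * binom i) = (\<Sum>j\<in>I - {i}. (const (inverse c) * h j) * binom j)"
    by (simp add: sum_distrib_left mult.assoc const_def single_uminus sum_negf)
  moreover have "const (- inverse c) * (const c * binom i) = - binom i"
    using c by (simp add: const_def mult_single mult.assoc[symmetric] single_uminus)
  ultimately have "binom i = (\<Sum>j\<in>I - {i}. (- const (inverse c) * h j) * binom j)"
    by (simp add: sum_negf) (metis minus_minus)
  also have "\<dots> \<in> lin_comb E (I - {i}) binom"
    using hE by (intro lin_combI indets_mult_subset) (simp_all add: indets_uminus indets_const)
  finally have bi: "binom i \<in> lin_comb E (I - {i}) (binom :: _ \<Rightarrow> ('v set, 'k) mpoly)" .
  have id: "ideal (lin_comb E (I - {i}) (binom :: _ \<Rightarrow> ('v set, 'k) mpoly)) (poly_ring E)"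
    using indets_binom by (intro ideal_lin_comb) auto
  have "T \<subseteq> lin_comb E (I - {i}) binom"
    unfolding generates[symmetric]
  proof (rule lin_comb_least[OF id])
    fix j assume "j \<in> I"
    then show "binom j \<in> lin_comb E (I - {i}) (binom :: _ \<Rightarrow> ('v set, 'k) mpoly)"
      using bi lin_comb_base[of "I - {i}" j] finite_I by (cases "j = i") auto
  qed
  moreover have "lin_comb E (I - {i}) binom \<subseteq> T"
    using binom_T by (intro lin_comb_least[OF ideal_T]) auto
  ultimately show False using minimal[OF i] by blast
qed

text \<open>The product of the ideal generated by all variables with \<open>T\<close>. A member of a minimal generating family
  never lies in it, and the restrictions on the shape of these binomials come from this.\<close>
definition mT :: "('v set, 'k) mpoly set" where
  "mT = {p. \<exists>g. (\<forall>i. indets (g i) \<subseteq> E \<and> Poly_Mapping.lookup (g i) 0 = 0) \<and> p = (\<Sum>i\<in>I. g i * binom i)}"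

lemma mT_I:
  "(\<And>i. indets (g i) \<subseteq> E) \<Longrightarrow> (\<And>i. Poly_Mapping.lookup (g i) 0 = 0) \<Longrightarrow> (\<Sum>i\<in>I. g i * binom i) \<in> mT"
  unfolding mT_def by (intro CollectI exI[of _ g]) simp

lemma mT_E:
  assumes "p \<in> mT"
  obtains g where "\<And>i. indets (g i) \<subseteq> E" "\<And>i. Poly_Mapping.lookup (g i) 0 = 0" "p = (\<Sum>i\<in>I. g i * binom i)"
proof -
  obtain g where "\<forall>i. indets (g i) \<subseteq> E \<and> Poly_Mapping.lookup (g i) 0 = 0" "p = (\<Sum>i\<in>I. g i * binom i)"
    using assms unfolding mT_def by (elim CollectE exE conjE)
  then show ?thesis by (intro that[of g]) blast+
qed

lemma T_E:
  assumes "p \<in> T"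
  obtains g where "\<And>i. indets (g i) \<subseteq> E" "p = (\<Sum>i\<in>I. g i * binom i)"
proof -
  obtain g where "\<forall>i. indets (g i) \<subseteq> E" "p = (\<Sum>i\<in>I. g i * binom i)"
    using assms unfolding generates[symmetric] lin_comb_def by (elim CollectE exE conjE)
  then show ?thesis by (intro that[of g]) blast+
qed

lemma mT_mult:
  assumes "p \<in> T" "indets h \<subseteq> E" "Poly_Mapping.lookup h 0 = 0"
  shows "h * p \<in> mT"
proof -
  obtain g where g: "\<And>i. indets (g i) \<subseteq> E" "p = (\<Sum>i\<in>I. g i * binom i)"
    by (rule T_E[OF assms(1)], rule that)
  have "h * p = (\<Sum>i\<in>I. (h * g i) * binom i)" by (simp add: g(2) sum_distrib_left mult.assoc)
  also have "\<dots> \<in> mT" using g(1) assms by (intro mT_I indets_mult_subset) (simp_all add: lookup_mult_zero)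
  finally show ?thesis .
qed

lemma mT_add:
  assumes "p \<in> mT" "q \<in> mT" shows "p + q \<in> mT"
proof -
  obtain g where g: "\<And>i. indets (g i) \<subseteq> E" "\<And>i. Poly_Mapping.lookup (g i) 0 = 0"
    "p = (\<Sum>i\<in>I. g i * binom i)"
    by (rule mT_E[OF assms(1)], rule that)
  obtain h where h: "\<And>i. indets (h i) \<subseteq> E" "\<And>i. Poly_Mapping.lookup (h i) 0 = 0"
    "q = (\<Sum>i\<in>I. h i * binom i)"
    by (rule mT_E[OF assms(2)], rule that)
  have "p + q = (\<Sum>i\<in>I. (g i + h i) * binom i)" by (simp add: g(3) h(3) distrib_right sum.distrib)
  also have "\<dots> \<in> mT" using g h by (intro mT_I indets_add_subset) (simp_all add: lookup_add)
  finally show ?thesis .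
qed

lemma mT_const_mult:
  assumes "p \<in> mT" shows "const c * p \<in> mT"
proof -
  obtain g where g: "\<And>i. indets (g i) \<subseteq> E" "\<And>i. Poly_Mapping.lookup (g i) 0 = 0"
    "p = (\<Sum>i\<in>I. g i * binom i)"
    by (rule mT_E[OF assms(1)], rule that)
  have "const c * p = (\<Sum>i\<in>I. (const c * g i) * binom i)" by (simp add: g(3) sum_distrib_left mult.assoc)
  also have "\<dots> \<in> mT"
    using g by (intro mT_I indets_mult_subset) (simp_all add: lookup_const_mult indets_const)
  finally show ?thesis .
qed

lemma mT_zero: "0 \<in> mT"
  using mT_I[of "\<lambda>_. 0"] by (simp add: indets_zero)

lemma mT_filt:
  assumes "p \<in> mT" shows "filt (\<lambda>m. Q (deg m)) p \<in> mT"
proof -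
  obtain g where g: "\<And>i. indets (g i) \<subseteq> E" "\<And>i. Poly_Mapping.lookup (g i) 0 = 0"
    "p = (\<Sum>i\<in>I. g i * binom i)"
    by (rule mT_E[OF assms(1)], rule that)
  show ?thesis unfolding g(3) filt_combination[OF subset_refl]
    by (intro mT_I subset_trans[OF indets_filt] g(1)) (simp add: lookup_filt g(2))
qed

lemma binom_notin_mT:
  assumes i: "i \<in> I" shows "binom i \<notin> mT"
proof
  assume mT: "binom i \<in> mT"
  obtain g :: "_ \<Rightarrow> ('v set, 'k) mpoly" where g: "\<And>j. indets (g j) \<subseteq> E" "\<And>j. Poly_Mapping.lookup (g j) 0 = 0"
    "binom i = (\<Sum>j\<in>I. g j * binom j)"
    by (rule mT_E[OF mT], rule that)
  define h where "h j = g j - (if j = i then 1 else 0)" for j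
  have "(\<Sum>j\<in>I. h j * binom j) = (\<Sum>j\<in>I. g j * binom j) - (\<Sum>j\<in>I. (if j = i then binom j else 0))"
    unfolding sum_subtractf[symmetric] by (rule sum.cong) (auto simp: h_def algebra_simps)
  also have "\<dots> = 0" using i finite_I g(3) by (simp add: sum.delta)
  finally have "(\<Sum>j\<in>I. h j * binom j) = 0" .
  moreover have "indets (h j) \<subseteq> E" for j
    unfolding h_def by (intro indets_diff_subset g(1)) (simp add: indets_one indets_zero)
  ultimately have "Poly_Mapping.lookup (h i) 0 = 0"
    using i by (intro syzygy_constant_term)
  then show False using g(2)[of i] by (simp add: h_def lookup_minus)
qed

text \<open>Otherwise \<open>x^(a1 + a2) - x^(b1 + b2)\<close> equals \<open>x^a2 (x^a1 - x^b1) + x^b1 (x^a2 - x^b2)\<close>, which lies in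
  \<open>mT\<close>.\<close>
lemma indecomposable:
  assumes "(a1 + a2, b1 + b2) \<in> I" "deg a1 = deg b1" "a1 \<noteq> 0"
  shows "a2 = 0"
proof (rule ccontr)
  assume a2: "a2 \<noteq> 0"
  have keys: "Poly_Mapping.keys a1 \<subseteq> E" "Poly_Mapping.keys a2 \<subseteq> E" "Poly_Mapping.keys b1 \<subseteq> E" "Poly_Mapping.keys b2 \<subseteq> E"
    using binomial[OF assms(1)] by (auto simp: keys_add_nat)
  have deg2: "deg a2 = deg b2" using binomial[OF assms(1)] assms(2) by (simp add: vdeg_add)
  have "deg a1 \<noteq> 0" using deg_eq_zero[of a1] keys(1) edge_card assms(3) by auto
  then have b1: "b1 \<noteq> 0" using assms(2) by auto
  have T1: "binom (a1, b1) \<in> T" "binom (a2, b2) \<in> T"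
    unfolding T using keys assms(2) deg2 by (intro binom_in_toric; simp)+
  have mono: "indets (monomial m :: ('v set, 'k) mpoly) \<subseteq> E" if "Poly_Mapping.keys m \<subseteq> E" for m
    using that indets_single[of m 1] by blast
  have "binom (a1 + a2, b1 + b2) = monomial a2 * binom (a1, b1) + monomial b1 * (binom (a2, b2) :: ('v set, 'k) mpoly)"
    by (simp add: binom_def right_diff_distrib mult_single add.commute)
  also have "\<dots> \<in> mT"
    using T1 keys a2 b1 by (intro mT_add mT_mult mono) (simp_all add: lookup_single when_def)
  finally show False using binom_notin_mT[OF assms(1)] by simp
qed

lemma disjoint_keys:
  assumes "(a, b) \<in> I" "e \<in> Poly_Mapping.keys a"
  shows "e \<notin> Poly_Mapping.keys b"
proof
  assume eb: "e \<in> Poly_Mapping.keys b"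
  define a2 b2 where "a2 = a - Poly_Mapping.single e 1" and "b2 = b - Poly_Mapping.single e 1"
  have a: "a = Poly_Mapping.single e 1 + a2" and b: "b = Poly_Mapping.single e 1 + b2"
    using split_single[OF assms(2)] split_single[OF eb] by (simp_all add: a2_def b2_def)
  have "Poly_Mapping.single e (1::nat) \<noteq> 0" by (metis lookup_single_eq lookup_zero one_neq_zero)
  then have a2: "a2 = 0" using indecomposable[of "Poly_Mapping.single e 1" a2 "Poly_Mapping.single e 1" b2] assms(1) a b by simp
  then have "deg b2 = 0" using binomial[OF assms(1)] unfolding a b by (simp add: vdeg_add)
  moreover have "Poly_Mapping.keys b2 \<subseteq> E" using binomial[OF assms(1)] b keys_add_nat by (metis Un_subset_iff)
  ultimately have "b2 = 0" using edge_card by (intro deg_eq_zero) auto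
  then show False using binomial[OF assms(1)] a b a2 by simp
qed

text \<open>The two opposite edge pairs of a four-cycle have the same degree, so \<open>a\<close> is no larger than one of them.\<close>
lemma square:
  assumes "(a, b) \<in> I" and distinct: "distinct [p, q, s, t]"
    and ab: "{p, q} \<in> Poly_Mapping.keys a" "{s, t} \<in> Poly_Mapping.keys a"
      "{p, s} \<in> Poly_Mapping.keys b" "{q, t} \<in> Poly_Mapping.keys b"
  shows "total a = 2"
proof -
  have two: "\<exists>r. m = (Poly_Mapping.single e 1 + Poly_Mapping.single f 1) + r"
    if "e \<in> Poly_Mapping.keys m" "f \<in> Poly_Mapping.keys m" "e \<noteq> f" for e f and m :: "'v set \<Rightarrow>\<^sub>0 nat"
  proof -
    have "f \<in> Poly_Mapping.keys (m - Poly_Mapping.single e 1)"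
      using that by (simp add: in_keys_iff lookup_minus lookup_single)
    then show ?thesis using split_single[OF that(1)] split_single by (metis add.assoc)
  qed
  obtain a2 where a2: "a = (Poly_Mapping.single {p, q} 1 + Poly_Mapping.single {s, t} 1) + a2"
    using two[OF ab(1,2)] distinct by (auto simp: doubleton_eq_iff)
  obtain b2 where b2: "b = (Poly_Mapping.single {p, s} 1 + Poly_Mapping.single {q, t} 1) + b2"
    using two[OF ab(3,4)] distinct by (auto simp: doubleton_eq_iff)
  have "a2 = 0"
  proof (rule indecomposable)
    show "(Poly_Mapping.single {p, q} 1 + Poly_Mapping.single {s, t} 1 + a2,
        Poly_Mapping.single {p, s} 1 + Poly_Mapping.single {q, t} 1 + b2) \<in> I"
      using assms(1) a2 b2 by simp
    show "deg (Poly_Mapping.single {p, q} 1 + Poly_Mapping.single {s, t} 1)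
        = deg (Poly_Mapping.single {p, s} 1 + Poly_Mapping.single {q, t} 1)"
      using distinct by (simp add: vdeg_add deg_pair add_ac)
    have "total (Poly_Mapping.single {p, q} 1 + Poly_Mapping.single {s, t} 1) = 2"
      by (simp add: total_add)
    then show "Poly_Mapping.single {p, q} (1::nat) + Poly_Mapping.single {s, t} 1 \<noteq> 0"
      by (metis total_zero zero_neq_numeral)
  qed
  then show ?thesis by (simp add: a2 total_add)
qed

text \<open>Let \<open>u = a - b\<close>. By disjointness of the two monomials, the edges with \<open>u > 0\<close> are those of \<open>a\<close> and
  the edges with \<open>u < 0\<close> those of \<open>b\<close>. The values of \<open>u\<close> at each vertex add up to zero. On two or
  three vertices this forces \<open>u = 0\<close>. On four vertices it forces opposite edges of the complete graph to
  have equal values and the values of the three perfect matchings to add up to zero; so one perfect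
  matching divides \<open>x^a\<close>, another divides \<open>x^b\<close>, and \<open>square\<close> applies.\<close>
lemma small_support:
  assumes ab: "(a, b) \<in> I" and small: "card (Poly_Mapping.keys (deg a)) \<le> 4"
  shows "card (Poly_Mapping.keys (deg a)) = 4 \<and> total a = 2"
proof -
  define W where "W = Poly_Mapping.keys (deg a)"
  have finW: "finite W" by (simp add: W_def)
  note bin = binomial[OF ab]
  have aW: "card e = 2 \<and> e \<subseteq> W" if "e \<in> Poly_Mapping.keys a" for e
    using that bin edge_card edge_finite edge_subset_keys_deg[of e a] unfolding W_def by blast
  have bW: "card e = 2 \<and> e \<subseteq> W" if "e \<in> Poly_Mapping.keys b" for e
    using that bin edge_card edge_finite edge_subset_keys_deg[of e b] unfolding W_def by (metis subsetD)
  define u where "u e = int (Poly_Mapping.lookup a e) - int (Poly_Mapping.lookup b e)" for e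
  have pos: "e \<in> Poly_Mapping.keys a" if "u e > 0" for e using that by (auto simp: u_def in_keys_iff)
  have neg: "e \<in> Poly_Mapping.keys b" if "u e < 0" for e using that by (auto simp: u_def in_keys_iff)
  have vertex: "(\<Sum>w\<in>W - {x}. u {x, w}) = 0" if "x \<in> W" for x
  proof -
    have "(\<Sum>w\<in>W - {x}. Poly_Mapping.lookup a {x, w}) = (\<Sum>w\<in>W - {x}. Poly_Mapping.lookup b {x, w})"
    proof -
      have "Poly_Mapping.lookup (deg a) x = (\<Sum>w\<in>W - {x}. Poly_Mapping.lookup a {x, w})"
        using finW that aW by (rule lookup_deg_complete)
      moreover have "Poly_Mapping.lookup (deg b) x = (\<Sum>w\<in>W - {x}. Poly_Mapping.lookup b {x, w})"
        using finW that bW by (rule lookup_deg_complete)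
      ultimately show ?thesis using bin by simp
    qed
    then show ?thesis unfolding u_def sum_subtractf by (simp flip: of_nat_sum)
  qed
  have "a \<noteq> 0"
  proof
    assume "a = 0"
    then have "deg b = 0" using bin by simp
    then have "b = 0" using bW by (intro deg_eq_zero) auto
    then show False using \<open>a = 0\<close> bin by simp
  qed
  then obtain e where e: "e \<in> Poly_Mapping.keys a" by (metis all_not_in_conv keys_eq_empty)
  from aW[OF e] obtain p q where pq: "e = {p, q}" "p \<noteq> q" "p \<in> W" "q \<in> W" by (auto simp: card_2_iff)
  have upq: "u {p, q} > 0" using e disjoint_keys[OF ab e] pq by (auto simp: u_def in_keys_iff)
  define R where "R = W - {p, q}"
  have finR: "finite R" using finW by (simp add: R_def)
  have W: "W = {p, q} \<union> R" using pq by (auto simp: R_def)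
  have "card W = card R + 2" unfolding W using finR pq(2) by (subst card_Un_disjoint) (auto simp: R_def)
  then have "card R \<le> 2" "card W = card R + 2" using small by (simp_all add: W_def)
  then consider "R = {}" | s where "R = {s}" | s t where "R = {s, t}" "s \<noteq> t"
    using finR by (metis card_0_eq card_1_singletonE card_2_iff le_Suc_eq le_zero_eq numeral_2_eq_2 One_nat_def)
  then show ?thesis
  proof cases
    case 1
    then have "W - {p} = {q}" using W pq by auto
    then show ?thesis using vertex[OF pq(3)] upq by simp
  next
    case (2 s)
    then have s: "s \<noteq> p" "s \<noteq> q" "s \<in> W" by (auto simp: R_def)
    have "W - {p} = {q, s}" "W - {q} = {p, s}" "W - {s} = {p, q}" using W 2 s pq by auto
    then have "u {p, q} + u {p, s} = 0" "u {p, q} + u {q, s} = 0" "u {p, s} + u {q, s} = 0"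
      using vertex[OF pq(3)] vertex[OF pq(4)] vertex[OF s(3)] s pq(2) by (simp_all add: insert_commute)
    then show ?thesis using upq by linarith
  next
    case (3 s t)
    then have s: "s \<noteq> p" "s \<noteq> q" "s \<in> W" and t: "t \<noteq> p" "t \<noteq> q" "t \<in> W" by (auto simp: R_def)
    have Ws: "W - {p} = {q, s, t}" "W - {q} = {p, s, t}" "W - {s} = {p, q, t}" "W - {t} = {p, q, s}"
      using W 3 s t pq by auto
    have eqs: "u {p, q} + (u {p, s} + u {p, t}) = 0" "u {p, q} + (u {q, s} + u {q, t}) = 0"
        "u {p, s} + (u {q, s} + u {s, t}) = 0" "u {p, t} + (u {q, t} + u {s, t}) = 0"
      using vertex[OF pq(3)] vertex[OF pq(4)] vertex[OF s(3)] vertex[OF t(3)] s t 3(2) pq(2)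
      unfolding Ws by (simp_all add: insert_commute)
    have st: "u {s, t} > 0" using eqs upq by linarith
    have "card W = 4" using \<open>card W = card R + 2\<close> 3 by simp
    moreover have "total a = 2"
    proof (cases "u {p, s} < 0")
      case True
      then have "u {q, t} < 0" using eqs by linarith
      then show ?thesis
        using True upq st pq(2) s t 3(2) by (intro square[OF ab, of p q s t] pos neg) auto
    next
      case False
      then have "u {p, t} < 0" "u {q, s} < 0" using eqs upq by linarith+
      then show ?thesis
        using upq st pq(2) s t 3(2)
        by (intro square[OF ab, of p q t s] pos neg) (auto simp: insert_commute)
    qed
    ultimately show ?thesis by (simp add: W_def)
  qed
qed

lemma total_deg_fst: "(a, b) \<in> I \<Longrightarrow> total (deg a) = 2 * total a"
  using binomial edge_card by (intro total_deg) blast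

lemma total_deg_snd: "(a, b) \<in> I \<Longrightarrow> total (deg b) = 2 * total b"
  using binomial edge_card by (intro total_deg) blast

lemma support_ge_4:
  assumes "(a, b) \<in> I" shows "4 \<le> card (Poly_Mapping.keys (deg a))"
  using small_support[OF assms] by linarith

lemma support_eq_4_iff:
  assumes "(a, b) \<in> I" shows "card (Poly_Mapping.keys (deg a)) = 4 \<longleftrightarrow> total a = 2"
  using small_support[OF assms] card_keys_le_total[of "deg a"] total_deg_fst[OF assms] by linarith

lemma homogeneous_binom:
  assumes "(a, b) \<in> I" "total a = 2"
  shows "homogeneous 2 (binom (a, b) :: ('v set, 'k) mpoly)"
proof -
  have "total b = 2" using total_deg_fst[OF assms(1)] total_deg_snd[OF assms(1)] binomial[OF assms(1)] assms(2) by simp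
  moreover have "m = a \<or> m = b" if "m \<in> Poly_Mapping.keys (binom (a, b) :: ('v set, 'k) mpoly)" for m
    using that by (auto simp: binom_def in_keys_iff lookup_minus lookup_single when_def split: if_splits)
  ultimately show ?thesis using assms(2) unfolding homogeneous_def total_def by blast
qed

text \<open>Let \<open>\<phi>\<close> be the projection onto ordinary degree at least three, expressed through the vertex degree, which
  has twice that total. A product of a quadric \<open>q\<close> in \<open>T\<close> with \<open>r\<close> is a scalar multiple of \<open>q\<close>, which \<open>\<phi>\<close>
  kills, plus an element of \<open>mT\<close>, which stays in \<open>mT\<close> under \<open>\<phi>\<close>. So if quadrics generate \<open>T\<close>,
  then \<open>\<phi>\<close> maps \<open>T\<close> into \<open>mT\<close>, and a minimal binomial of degree at least three would lie in \<open>mT\<close>.\<close>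
lemma quadric_generators:
  assumes Q: "Q \<subseteq> {q \<in> carrier (poly_ring E). homogeneous 2 q}" "T = genideal (poly_ring E) Q"
    and ab: "(a, b) \<in> I"
  shows "total a = 2"
proof (rule ccontr)
  assume "total a \<noteq> 2"
  then have big: "6 \<le> total (deg a)"
    using support_ge_4[OF ab] card_keys_le_total[of "deg a"] total_deg_fst[OF ab] by linarith
  interpret R: cring "poly_ring E :: ('v set, 'k) mpoly ring" by (rule poly_ring_cring)
  define \<phi> where "\<phi> = (filt (\<lambda>m. 6 \<le> total (deg m)) :: ('v set, 'k) mpoly \<Rightarrow> _)"
  have QT: "Q \<subseteq> T" unfolding Q(2) using Q(1) by (intro R.genideal_self) auto
  have "ideal {p \<in> T. \<phi> p \<in> mT} (poly_ring E)"
  proof (rule ideal_poly_ringI)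
    show "p + q \<in> {p \<in> T. \<phi> p \<in> mT}" if "p \<in> {p \<in> T. \<phi> p \<in> mT}" "q \<in> {p \<in> T. \<phi> p \<in> mT}" for p q
      using that ideal_poly_ringD(3)[OF ideal_T] mT_add by (auto simp: \<phi>_def filt_add)
    fix p r :: "('v set, 'k) mpoly"
    assume p: "p \<in> {p \<in> T. \<phi> p \<in> mT}" and r: "indets r \<subseteq> E"
    define c where "c = Poly_Mapping.lookup r 0"
    have "r * p = (r - const c) * p + const c * p" by (simp add: algebra_simps)
    moreover have "(r - const c) * p \<in> mT"
      using p r by (intro mT_mult indets_diff_subset) (auto simp: indets_const lookup_minus c_def lookup_const_zero)
    then have "\<phi> ((r - const c) * p) \<in> mT" unfolding \<phi>_def by (rule mT_filt)
    moreover have "\<phi> (const c * p) = const c * \<phi> p"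
      by (rule poly_mapping_eqI) (simp add: \<phi>_def lookup_filt lookup_const_mult)
    then have "\<phi> (const c * p) \<in> mT" using p mT_const_mult by simp
    ultimately have "\<phi> (r * p) \<in> mT" using mT_add by (simp add: \<phi>_def filt_add)
    then show "r * p \<in> {p \<in> T. \<phi> p \<in> mT}" using p r ideal_poly_ringD(4)[OF ideal_T] by auto
  qed (use ideal_poly_ringD(1,2)[OF ideal_T] mT_zero in \<open>auto simp: \<phi>_def\<close>)
  moreover have "Q \<subseteq> {p \<in> T. \<phi> p \<in> mT}"
  proof
    fix q assume q: "q \<in> Q"
    then have qE: "indets q \<subseteq> E" "homogeneous 2 q" using Q(1) by (auto simp: poly_ring_def)
    have "\<phi> q = 0"
    proof (rule poly_mapping_eqI)
      fix m
      have "total (deg m) = 4" if "m \<in> Poly_Mapping.keys q"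
      proof -
        have "total (deg m) = 2 * total m" using qE(1) that edge_card by (intro total_deg) (auto simp: indets_def)
        moreover have "total m = 2" using qE(2) that by (simp add: homogeneous_def total_def)
        ultimately show ?thesis by simp
      qed
      then show "Poly_Mapping.lookup (\<phi> q) m = Poly_Mapping.lookup 0 m"
        by (cases "Poly_Mapping.lookup q m = 0") (auto simp: \<phi>_def lookup_filt in_keys_iff)
    qed
    then show "q \<in> {p \<in> T. \<phi> p \<in> mT}" using q QT mT_zero by auto
  qed
  ultimately have "T \<subseteq> {p \<in> T. \<phi> p \<in> mT}" unfolding Q(2) by (rule R.genideal_minimal)
  then have "\<phi> (binom (a, b)) \<in> mT" using binom_T[OF ab] by blast
  moreover have "\<phi> (binom (a, b)) = binom (a, b)"
    unfolding \<phi>_def by (rule filt_id) (use binom_deg[OF ab] big in auto)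
  ultimately show False using binom_notin_mT[OF ab] by simp
qed

text \<open>Express the binomials in terms of \<open>S\<close> and \<open>S\<close> in terms of the binomials. The product of the two
  coefficient matrices differs from the identity by syzygies, which vanish at the origin, so the constant
  terms of the two matrices factor the identity.\<close>
lemma card_le_generators:
  assumes "finite S" "S \<subseteq> carrier (poly_ring E)" "genideal (poly_ring E) S = T"
  shows "card I \<le> card S"
proof -
  have SE: "\<And>s. s \<in> S \<Longrightarrow> indets s \<subseteq> E" using assms(2) by (auto simp: poly_ring_def)
  have S: "lin_comb E S (\<lambda>s. s) = T" using genideal_lin_comb[of S "\<lambda>s. s" E] SE assms(1,3) by simp
  have "\<forall>i\<in>I. \<exists>g. (\<forall>s. indets (g s) \<subseteq> E) \<and> binom i = (\<Sum>s\<in>S. g s * s)"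
    using binom_T unfolding S[symmetric] lin_comb_def by blast
  from bchoice[OF this] obtain A
    where A': "\<forall>i\<in>I. (\<forall>s. indets (A i s) \<subseteq> E) \<and> binom i = (\<Sum>s\<in>S. A i s * s)" ..
  have A: "indets (A i s) \<subseteq> E" "binom i = (\<Sum>s\<in>S. A i s * s)" if "i \<in> I" for i s
    using bspec[OF A' that] by blast+
  have ST: "s \<in> T" if "s \<in> S" for s using lin_comb_base[OF assms(1) that, of "\<lambda>s. s" E] S by simp
  have "\<forall>s\<in>S. \<exists>g. (\<forall>i. indets (g i) \<subseteq> E) \<and> s = (\<Sum>i\<in>I. g i * binom i)"
    using ST unfolding generates[symmetric] lin_comb_def by blast
  from bchoice[OF this] obtain B
    where B': "\<forall>s\<in>S. (\<forall>i. indets (B s i) \<subseteq> E) \<and> s = (\<Sum>i\<in>I. B s i * binom i)" ..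
  have B: "indets (B s i) \<subseteq> E" "s = (\<Sum>i\<in>I. B s i * binom i)" if "s \<in> S" for i s
    using bspec[OF B' that] by blast+
  show ?thesis
  proof (rule identity_factorization_le[OF finite_I assms(1)])
    fix i j assume i: "i \<in> I" and j: "j \<in> I"
    define g where "g j = (\<Sum>s\<in>S. A i s * B s j) - (if j = i then 1 else 0)" for j
    have "(\<Sum>j\<in>I. g j * binom j) = (\<Sum>j\<in>I. (\<Sum>s\<in>S. A i s * B s j) * binom j) - (\<Sum>j\<in>I. if j = i then binom j else 0)"
      unfolding sum_subtractf[symmetric] by (rule sum.cong) (auto simp: g_def algebra_simps)
    also have "(\<Sum>j\<in>I. if j = i then binom j else 0) = (binom i :: ('v set, 'k) mpoly)" using i finite_I by (simp add: sum.delta)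
    also have "(\<Sum>j\<in>I. (\<Sum>s\<in>S. A i s * B s j) * binom j) = (\<Sum>s\<in>S. A i s * (\<Sum>j\<in>I. B s j * binom j))"
      unfolding sum_distrib_left sum_distrib_right by (subst sum.swap) (simp add: mult.assoc)
    also have "\<dots> = (\<Sum>s\<in>S. A i s * s)" using B(2) by (intro sum.cong) auto
    also have "\<dots> = binom i" using A(2)[OF i] by simp
    finally have "(\<Sum>j\<in>I. g j * binom j) = 0" by simp
    moreover have "indets (g j) \<subseteq> E" for j
      unfolding g_def using A(1)[OF i] B(1)
      by (intro indets_diff_subset indets_sum indets_mult_subset) (auto simp: indets_one indets_zero)
    ultimately have "Poly_Mapping.lookup (g j) 0 = 0" using j by (intro syzygy_constant_term)
    then show "(\<Sum>s\<in>S. Poly_Mapping.lookup (A i s) 0 * Poly_Mapping.lookup (B s j) 0) = (if i = j then 1 else 0)"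
      by (auto simp: g_def lookup_minus lookup_sum lookup_mult_zero)
  qed
qed

end

text \<open>Each generator lies in the ideal of the finitely many binomials formed by its terms. A subset of these
  of smallest cardinality that still generates is minimal.\<close>
lemma toric_binomials_exist:
  assumes graph: "simple_graph V E" and "finite S" "S \<subseteq> carrier (poly_ring E)"
    and S: "genideal (poly_ring E) S = (toric_ideal V E :: ('v set, 'k::field) mpoly set)"
  obtains I where "toric_binomials V E I (toric_ideal V E :: ('v set, 'k) mpoly set)"
proof -
  let ?T = "toric_ideal V E :: ('v set, 'k) mpoly set"
  have SE: "\<And>s. s \<in> S \<Longrightarrow> indets s \<subseteq> E" using assms(3) by (auto simp: poly_ring_def)
  have SL: "lin_comb E S (\<lambda>s. s) = ?T" using genideal_lin_comb[of S "\<lambda>s. s" E] SE assms(2) S by simp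
  have ST: "s \<in> ?T" if "s \<in> S" for s using lin_comb_base[OF assms(2) that, of "\<lambda>s. s" E] SL by simp
  define P where "P = {(a, b). a \<noteq> b \<and> deg a = deg b} \<inter> (\<Union>s\<in>S. Poly_Mapping.keys s \<times> Poly_Mapping.keys s)"
  have finP: "finite P" using assms(2) by (auto simp: P_def)
  have P: "Poly_Mapping.keys a \<subseteq> E \<and> Poly_Mapping.keys b \<subseteq> E \<and> a \<noteq> b \<and> deg a = deg b" if "(a, b) \<in> P" for a b
    using that SE unfolding P_def indets_def by blast
  have binT: "binom i \<in> ?T" if "i \<in> P" for i
    using P[of "fst i" "snd i"] that binom_in_toric[of "fst i" E "snd i" V] by simp
  have PT: "lin_comb E P (binom :: _ \<Rightarrow> ('v set, 'k) mpoly) = ?T"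
  proof
    show "lin_comb E P binom \<subseteq> ?T" using binT by (intro lin_comb_least[OF ideal_toric])
    have id: "ideal (lin_comb E P (binom :: _ \<Rightarrow> ('v set, 'k) mpoly)) (poly_ring E)"
      using toric_ideal_indets[OF binT] by (intro ideal_lin_comb)
    show "?T \<subseteq> lin_comb E P binom" unfolding SL[symmetric]
    proof (rule lin_comb_least[OF id])
      fix s assume s: "s \<in> S"
      show "s \<in> lin_comb E P binom"
      proof (rule toric_binomial_induct[OF ST[OF s] id])
        fix a b assume "a \<in> Poly_Mapping.keys s" "b \<in> Poly_Mapping.keys s" "deg a = deg b" "a \<noteq> b"
        then have "(a, b) \<in> P" using s by (auto simp: P_def)
        then show "binom (a, b) \<in> lin_comb E P (binom :: _ \<Rightarrow> ('v set, 'k) mpoly)" by (rule lin_comb_base[OF finP])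
      qed
    qed
  qed
  define good where "good I \<longleftrightarrow> I \<subseteq> P \<and> lin_comb E I (binom :: _ \<Rightarrow> ('v set, 'k) mpoly) = ?T" for I
  have "good P" using PT by (simp add: good_def)
  then obtain I where I: "good I" "\<And>J. good J \<Longrightarrow> card I \<le> card J"
    using ex_has_least_nat[of good P card] by blast
  have finI: "finite I" using I(1) finP finite_subset by (auto simp: good_def)
  have "toric_binomials V E I ?T"
  proof
    show "lin_comb E (I - {i}) (binom :: _ \<Rightarrow> ('v set, 'k) mpoly) \<noteq> ?T" if "i \<in> I" for i
    proof
      assume "lin_comb E (I - {i}) (binom :: _ \<Rightarrow> ('v set, 'k) mpoly) = ?T"
      then have "good (I - {i})" using I(1) by (auto simp: good_def)
      then have "card I \<le> card (I - {i})" by (rule I(2))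
      then show False using card_Diff1_less[OF finI that] by simp
    qed
  qed (use graph finI I(1) P in \<open>auto simp: good_def\<close>)
  then show ?thesis by (rule that)
qed

section \<open>Binomial generators and the cycle space\<close>

text \<open>The two terms of each multiple \<open>x^c (x^a - x^b)\<close> receive the same value.\<close>
lemma lsum_binomial_multiple:
  assumes "\<And>x. \<phi> (x + a) = \<phi> (x + b)"
  shows "lsum \<phi> (h * binom (a, b)) = 0"
proof (induction h rule: poly_induct)
  case zero then show ?case by simp
next
  case (add q r) then show ?case by (simp add: distrib_right lsum_add)
next
  case (single x)
  then show ?case by (simp add: binom_def right_diff_distrib mult_single lsum_diff assms)
qed

lemma simple_graph_induced:
  "simple_graph V E \<Longrightarrow> W \<subseteq> V \<Longrightarrow> simple_graph W (induced_edges E W)"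
  by (auto simp: simple_graph_def induced_edges_def finite_subset)

context toric_binomials
begin

definition supported :: "'v set \<Rightarrow> (('v set \<Rightarrow>\<^sub>0 nat) \<times> ('v set \<Rightarrow>\<^sub>0 nat)) set" where
  "supported W = {i \<in> I. Poly_Mapping.keys (deg (fst i)) \<subseteq> W}"

lemma supported_edges:
  assumes "i \<in> supported W" "e \<in> Poly_Mapping.keys (fst i) \<union> Poly_Mapping.keys (snd i)"
  shows "e \<in> induced_edges E W"
proof -
  obtain a b where i: "i = (a, b)" by (cases i)
  have ab: "(a, b) \<in> I" and W: "Poly_Mapping.keys (deg a) \<subseteq> W" "Poly_Mapping.keys (deg b) \<subseteq> W"
    using assms(1) binomial[of a b] by (auto simp: supported_def i)
  have E: "Poly_Mapping.keys a \<subseteq> E" "Poly_Mapping.keys b \<subseteq> E" using binomial[OF ab] by auto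
  have "e \<subseteq> Poly_Mapping.keys (deg a) \<or> e \<subseteq> Poly_Mapping.keys (deg b)"
    using assms(2) i E edge_finite edge_subset_keys_deg[of e a] edge_subset_keys_deg[of e b] by auto
  moreover have "e \<in> E" using assms(2) i E by auto
  ultimately show ?thesis using W by (auto simp: induced_edges_def)
qed

lemma exponent_diff_cycle:
  assumes "i \<in> supported W"
  shows "exponent_diff i \<in> cycle_space (induced_edges E W)"
proof -
  obtain a b where i: "i = (a, b)" by (cases i)
  have ab: "(a, b) \<in> I" using assms by (simp add: supported_def i)
  let ?E = "induced_edges E W"
  have fin: "finite ?E" using finite_E by (simp add: induced_edges_def)
  have sub: "Poly_Mapping.keys a \<subseteq> ?E" "Poly_Mapping.keys b \<subseteq> ?E"
    using supported_edges[OF assms] by (auto simp: i)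
  have fe: "finite e" if "e \<in> ?E" for e using that edge_finite by (simp add: induced_edges_def)
  have "(\<Sum>e\<in>?E. exponent_diff i e * incidence e v) = 0" for v
  proof -
    have "of_nat (Poly_Mapping.lookup (deg a) v) = (\<Sum>e\<in>?E. of_nat (Poly_Mapping.lookup a e) * incidence e v)"
      using fin sub(1) fe by (rule deg_incidence)
    moreover have "of_nat (Poly_Mapping.lookup (deg b) v) = (\<Sum>e\<in>?E. of_nat (Poly_Mapping.lookup b e) * incidence e v)"
      using fin sub(2) fe by (rule deg_incidence)
    ultimately show ?thesis
      using binomial[OF ab] by (simp add: exponent_diff_def i left_diff_distrib sum_subtractf)
  qed
  moreover have "exponent_diff i e = 0" if "e \<notin> ?E" for e
  proof -
    have "e \<notin> Poly_Mapping.keys a" "e \<notin> Poly_Mapping.keys b" using that sub by auto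
    then show ?thesis by (simp add: exponent_diff_def i in_keys_iff)
  qed
  ultimately show ?thesis by (simp add: cycle_space_def)
qed

text \<open>Projecting a representation of \<open>x^a - x^b\<close> to the monomials with degree supported in \<open>W\<close> leaves only
  binomials supported in \<open>W\<close>. The functional that adds up the coefficients of all monomials in the same
  class as \<open>a\<close> modulo the span of their exponent differences vanishes on their ideal, hence on
  \<open>x^a - x^b\<close>, which is possible only if \<open>b\<close> is in this class. Since the span is taken over the
  rationals, the argument works in every characteristic.\<close>
lemma toric_binomial_in_span:
  assumes a: "Poly_Mapping.keys a \<subseteq> induced_edges E W" and b: "Poly_Mapping.keys b \<subseteq> induced_edges E W"
    and deg: "deg a = deg b"
  shows "exponent_diff (a, b) \<in> fun_space.span (exponent_diff ` supported W)"
proof -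
  let ?S = "fun_space.span (exponent_diff ` supported W)"
  have sup: "supported W \<subseteq> I" by (auto simp: supported_def)
  have aE: "Poly_Mapping.keys a \<subseteq> E" and bE: "Poly_Mapping.keys b \<subseteq> E" using a b by (auto simp: induced_edges_def)
  have abT: "binom (a, b) \<in> T" unfolding T using aE bE deg by (rule binom_in_toric)
  obtain g :: "_ \<Rightarrow> ('v set, 'k) mpoly"
    where g: "\<And>i. indets (g i) \<subseteq> E" "binom (a, b) = (\<Sum>i\<in>I. g i * binom i)"
    by (rule T_E[OF abT], rule that)
  have degW: "Poly_Mapping.keys (deg m) \<subseteq> W" if "Poly_Mapping.keys m \<subseteq> induced_edges E W" for m
    using keys_vdeg_subset[of m W "\<lambda>v. v"] that by (auto simp: induced_edges_def)
  have keys_ab: "m = a \<or> m = b" if "m \<in> Poly_Mapping.keys (binom (a, b) :: ('v set, 'k) mpoly)" for m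
    using that by (auto simp: binom_def in_keys_iff lookup_minus lookup_single when_def split: if_splits)
  define h where "h i = filt (\<lambda>m. Poly_Mapping.keys (deg m + deg (fst i)) \<subseteq> W) (g i)" for i
  have "binom (a, b) = filt (\<lambda>m. Poly_Mapping.keys (deg m) \<subseteq> W) (binom (a, b) :: ('v set, 'k) mpoly)"
    using keys_ab degW[OF a] degW[OF b] by (intro filt_id[symmetric]) blast
  also have "\<dots> = (\<Sum>i\<in>I. h i * binom i)"
    unfolding g(2) h_def by (rule filt_combination[OF subset_refl, where Q = "\<lambda>d. Poly_Mapping.keys d \<subseteq> W"])
  also have "\<dots> = (\<Sum>i\<in>supported W. h i * binom i)"
  proof (rule sum.mono_neutral_right[OF finite_I sup], rule ballI)
    fix i assume "i \<in> I - supported W"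
    then have "\<not> Poly_Mapping.keys (deg m + deg (fst i)) \<subseteq> W" for m
      by (auto simp: supported_def keys_add_nat)
    then have "h i = 0" by (intro poly_mapping_eqI) (simp add: h_def lookup_filt)
    then show "h i * binom i = 0" by simp
  qed
  finally have eq: "binom (a, b) = (\<Sum>i\<in>supported W. h i * (binom i :: ('v set, 'k) mpoly))" .
  define \<phi> :: "('v set \<Rightarrow>\<^sub>0 nat) \<Rightarrow> 'k" where "\<phi> m = (if exponent_diff (a, m) \<in> ?S then 1 else 0)" for m
  have \<phi>: "\<phi> (x + fst i) = \<phi> (x + snd i)" if i: "i \<in> supported W" for x i
  proof -
    have base: "exponent_diff i \<in> ?S" using i by (intro fun_space.span_base) auto
    have e1: "exponent_diff (a, x + snd i) = exponent_diff (a, x + fst i) + exponent_diff i"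
      by (auto simp: fun_eq_iff exponent_diff_def lookup_add)
    then have e2: "exponent_diff (a, x + fst i) = exponent_diff (a, x + snd i) - exponent_diff i" by simp
    have "exponent_diff (a, x + fst i) \<in> ?S \<longleftrightarrow> exponent_diff (a, x + snd i) \<in> ?S"
      using fun_space.span_add[OF _ base] fun_space.span_diff[OF _ base] e1 e2 by metis
    then show ?thesis by (simp add: \<phi>_def)
  qed
  have "lsum \<phi> (binom (a, b)) = (\<Sum>i\<in>supported W. lsum \<phi> (h i * binom i))"
    unfolding eq by (rule lsum_sum)
  also have "\<dots> = 0"
  proof (rule sum.neutral, rule ballI)
    fix i assume "i \<in> supported W"
    then show "lsum \<phi> (h i * binom i) = 0"
      using lsum_binomial_multiple[of \<phi> "fst i" "snd i" "h i"] \<phi> by simp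
  qed
  finally have "\<phi> a = \<phi> b" by (simp add: binom_def lsum_diff)
  moreover have "exponent_diff (a, a) = 0" by (auto simp: fun_eq_iff exponent_diff_def)
  then have "\<phi> a = 1" by (simp add: \<phi>_def fun_space.span_zero)
  ultimately show ?thesis by (simp add: \<phi>_def split: if_splits)
qed

text \<open>A rational element of the cycle space is, after clearing denominators, the exponent difference of a
  binomial in the toric ideal of the induced subgraph.\<close>
lemma cycle_space_span:
  assumes w: "w \<in> cycle_space (induced_edges E W)"
  shows "w \<in> fun_space.span (exponent_diff ` supported W)"
proof -
  let ?E = "induced_edges E W"
  have fin: "finite ?E" using finite_E by (simp add: induced_edges_def)
  have fe: "finite e" if "e \<in> ?E" for e using that edge_finite by (simp add: induced_edges_def)
  obtain N :: nat where N: "N > 0" "\<forall>e\<in>?E. \<exists>z::int. of_nat N * w e = of_int z"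
    using clear_denominators[OF fin, of w] by blast
  from bchoice[OF N(2)] obtain z :: "'v set \<Rightarrow> int" where z: "\<forall>e\<in>?E. of_nat N * w e = of_int (z e)" ..
  define a where "a = exponent ?E (\<lambda>e. nat (z e))"
  define b where "b = exponent ?E (\<lambda>e. nat (- z e))"
  have sub: "Poly_Mapping.keys a \<subseteq> ?E" "Poly_Mapping.keys b \<subseteq> ?E"
    using fin by (auto simp: a_def b_def in_keys_iff lookup_exponent split: if_splits)
  have diff: "exponent_diff (a, b) = fscale (of_nat N) w"
  proof
    fix e
    show "exponent_diff (a, b) e = fscale (of_nat N) w e"
    proof (cases "e \<in> ?E")
      case True
      have "of_nat (nat (z e)) - of_nat (nat (- z e)) = (of_int (z e) :: rat)"
        by (cases "z e \<ge> 0") auto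
      then show ?thesis using True z fin by (simp add: exponent_diff_def a_def b_def lookup_exponent fscale_apply)
    next
      case False
      then show ?thesis using w fin by (simp add: exponent_diff_def a_def b_def lookup_exponent fscale_apply cycle_space_def)
    qed
  qed
  have "deg a = deg b"
  proof (rule poly_mapping_eqI)
    fix v
    have "of_nat (Poly_Mapping.lookup (deg a) v) = (\<Sum>e\<in>?E. of_nat (Poly_Mapping.lookup a e) * incidence e v)"
      using fin sub(1) fe by (rule deg_incidence)
    moreover have "of_nat (Poly_Mapping.lookup (deg b) v) = (\<Sum>e\<in>?E. of_nat (Poly_Mapping.lookup b e) * incidence e v)"
      using fin sub(2) fe by (rule deg_incidence)
    ultimately have "of_nat (Poly_Mapping.lookup (deg a) v) - of_nat (Poly_Mapping.lookup (deg b) v)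
        = (\<Sum>e\<in>?E. exponent_diff (a, b) e * incidence e v)"
      by (simp add: exponent_diff_def left_diff_distrib sum_subtractf)
    also have "\<dots> = of_nat N * (\<Sum>e\<in>?E. w e * incidence e v)"
      unfolding diff by (simp add: fscale_apply sum_distrib_left mult.assoc)
    also have "\<dots> = 0" using w by (simp add: cycle_space_def)
    finally show "Poly_Mapping.lookup (deg a) v = Poly_Mapping.lookup (deg b) v" by simp
  qed
  then have "fscale (of_nat N) w \<in> fun_space.span (exponent_diff ` supported W)"
    using toric_binomial_in_span[OF sub] diff by simp
  then have "fscale (inverse (of_nat N)) (fscale (of_nat N) w) \<in> fun_space.span (exponent_diff ` supported W)"
    by (rule fun_space.span_scale)
  moreover have "fscale (inverse (of_nat N)) (fscale (of_nat N) w) = w"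
    using N(1) by (auto simp: fun_eq_iff fscale_apply)
  ultimately show ?thesis by metis
qed

lemma finite_supported: "finite (supported W)"
  using finite_I by (simp add: supported_def)

lemma cycle_space_combination:
  assumes "w \<in> cycle_space (induced_edges E W)"
  shows "\<exists>c. \<forall>e. w e = (\<Sum>i\<in>supported W. c i * exponent_diff i e)"
  using span_family[OF finite_supported cycle_space_span[OF assms]] by metis

lemma supported_V: "supported V = I" and induced_V: "induced_edges E V = E"
proof -
  have "Poly_Mapping.keys (deg (fst i)) \<subseteq> V" if "i \<in> I" for i
  proof -
    have "Poly_Mapping.keys (fst i) \<subseteq> E" using binomial[of "fst i" "snd i"] that by simp
    then show ?thesis using keys_vdeg_subset[of "fst i" V "\<lambda>v. v"] edge_subset by auto
  qed
  then show "supported V = I" by (auto simp: supported_def)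
  show "induced_edges E V = E" using edge_subset by (auto simp: induced_edges_def)
qed

lemma supported_card_ge:
  assumes "W \<subseteq> V"
  shows "card (induced_edges E W) + num_bipartite_components W (induced_edges E W) \<le> card (supported W) + card W"
  using simple_graph_induced[OF graph assms] finite_supported cycle_space_combination
  by (rule cycle_space_spanning_ge)

text \<open>The assumption of the following block is what a complete intersection provides: there are no more
  binomials than the dimension of the cycle space.\<close>
context
  assumes few: "card I + card V \<le> card E + num_bipartite_components V E"
begin

text \<open>A dependent member could be omitted from the family without changing its span, which would leave too
  few vectors to span the cycle space.\<close>
lemma exponent_diffs_independent:
  assumes "\<And>e. (\<Sum>i\<in>I. c i * exponent_diff i e) = 0"
  shows "\<forall>i\<in>I. c i = 0"
proof (rule ccontr)
  assume "\<not> ?thesis"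
  then obtain j where j: "j \<in> I" "c j \<noteq> 0" by blast
  have cj: "exponent_diff j e = (\<Sum>i\<in>I - {j}. (- c i / c j) * exponent_diff i e)" for e
  proof -
    have "c j * exponent_diff j e = - (\<Sum>i\<in>I - {j}. c i * exponent_diff i e)"
      using assms[of e] finite_I j(1) by (simp add: sum.remove eq_neg_iff_add_eq_0)
    then have "exponent_diff j e = - (\<Sum>i\<in>I - {j}. c i * exponent_diff i e) / c j"
      using j(2) by (simp add: field_simps)
    then show ?thesis by (simp add: sum_divide_distrib sum_negf)
  qed
  have "card E + num_bipartite_components V E \<le> card (I - {j}) + card V"
  proof (rule cycle_space_spanning_ge[OF graph])
    show "finite (I - {j})" using finite_I by simp
    fix w assume "w \<in> cycle_space E"
    then obtain d where d: "\<And>e. w e = (\<Sum>i\<in>I. d i * exponent_diff i e)"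
      using cycle_space_combination[of w V] by (auto simp: supported_V induced_V)
    have "w e = (\<Sum>i\<in>I - {j}. (d i + d j * (- c i / c j)) * exponent_diff i e)" for e
    proof -
      have "w e = d j * exponent_diff j e + (\<Sum>i\<in>I - {j}. d i * exponent_diff i e)"
        unfolding d using finite_I j(1) by (rule sum.remove)
      also have "d j * exponent_diff j e = (\<Sum>i\<in>I - {j}. (d j * (- c i / c j)) * exponent_diff i e)"
        unfolding cj[of e] by (simp only: sum_distrib_left mult.assoc)
      finally show ?thesis by (simp only: sum.distrib[symmetric] distrib_right add.commute)
    qed
    then show "\<exists>c. \<forall>e. w e = (\<Sum>i\<in>I - {j}. c i * exponent_diff i e)"
      by (intro exI[of _ "\<lambda>i. d i + d j * (- c i / c j)"] allI)
  qed
  moreover have "card (I - {j}) < card I" using finite_I j(1) by (rule card_Diff1_less)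
  ultimately show False using few by simp
qed

text \<open>Subfamilies inherit independence, so those supported in \<open>W\<close> form a basis of the cycle space of the
  induced subgraph.\<close>
lemma card_supported:
  assumes "W \<subseteq> V"
  shows "card (supported W) + card W = card (induced_edges E W) + num_bipartite_components W (induced_edges E W)"
proof (rule antisym)
  show "card (supported W) + card W \<le> card (induced_edges E W) + num_bipartite_components W (induced_edges E W)"
  proof (rule cycle_space_independent_le[OF simple_graph_induced[OF graph assms] finite_supported, of W exponent_diff])
    show "exponent_diff i \<in> cycle_space (induced_edges E W)" if "i \<in> supported W" for i
      using that by (rule exponent_diff_cycle)
    fix c assume c: "\<And>e. (\<Sum>i\<in>supported W. c i * exponent_diff i e) = 0"
    define d where "d i = (if i \<in> supported W then c i else 0)" for i
    have "(\<Sum>i\<in>I. d i * exponent_diff i e) = 0" for e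
    proof -
      have "(\<Sum>i\<in>I. d i * exponent_diff i e) = (\<Sum>i\<in>I. if i \<in> supported W then c i * exponent_diff i e else 0)"
        by (rule sum.cong) (auto simp: d_def)
      also have "\<dots> = (\<Sum>i\<in>I \<inter> supported W. c i * exponent_diff i e)"
        by (rule sum.inter_restrict[OF finite_I, symmetric])
      also have "I \<inter> supported W = supported W" by (auto simp: supported_def)
      finally show ?thesis using c by simp
    qed
    then have "\<forall>i\<in>I. d i = 0" by (rule exponent_diffs_independent)
    then show "\<forall>i\<in>supported W. c i = 0" by (auto simp: d_def supported_def)
  qed
qed (rule supported_card_ge[OF assms])

end

lemma quadrics_iff:
  "(\<exists>Q. Q \<subseteq> {q \<in> carrier (poly_ring E). homogeneous 2 q} \<and> T = genideal (poly_ring E) Q) \<longleftrightarrow>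
   (\<forall>i\<in>I. card (Poly_Mapping.keys (deg (fst i))) = 4)"
proof
  assume "\<exists>Q. Q \<subseteq> {q \<in> carrier (poly_ring E). homogeneous 2 q} \<and> T = genideal (poly_ring E) Q"
  then obtain Q where "Q \<subseteq> {q \<in> carrier (poly_ring E). homogeneous 2 q}" "T = genideal (poly_ring E) Q" by blast
  then have "total a = 2" if "(a, b) \<in> I" for a b using that by (rule quadric_generators)
  then show "\<forall>i\<in>I. card (Poly_Mapping.keys (deg (fst i))) = 4" using support_eq_4_iff by auto
next
  assume *: "\<forall>i\<in>I. card (Poly_Mapping.keys (deg (fst i))) = 4"
  have "homogeneous 2 (binom i :: ('v set, 'k) mpoly)" if "i \<in> I" for i
    using homogeneous_binom[of "fst i" "snd i"] support_eq_4_iff[of "fst i" "snd i"] that * by simp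
  then have "binom ` I \<subseteq> {q \<in> carrier (poly_ring E :: ('v set, 'k) mpoly ring). homogeneous 2 q}"
    using indets_binom by (simp add: poly_ring_def image_subset_iff del: split_paired_All)
  moreover have "T = genideal (poly_ring E) (binom ` I)"
    using genideal_lin_comb[OF finite_I indets_binom] generates by simp
  ultimately show "\<exists>Q. Q \<subseteq> {q \<in> carrier (poly_ring E). homogeneous 2 q} \<and> T = genideal (poly_ring E) Q" by blast
qed

end

section \<open>Counting the generators at each vertex\<close>

lemma sum_card_containing:
  assumes "finite X" "finite V" "\<And>x. x \<in> X \<Longrightarrow> f x \<subseteq> V"
  shows "(\<Sum>v\<in>V. card {x \<in> X. v \<in> f x}) = (\<Sum>x\<in>X. card (f x))"
proof -
  have "(\<Sum>v\<in>V. card {x \<in> X. v \<in> f x}) = (\<Sum>v\<in>V. \<Sum>x\<in>X. if v \<in> f x then 1 else 0)"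
    using assms(1) by (simp flip: sum.inter_filter)
  also have "\<dots> = (\<Sum>x\<in>X. \<Sum>v\<in>V. if v \<in> f x then 1 else 0)" by (rule sum.swap)
  also have "\<dots> = (\<Sum>x\<in>X. card (f x))"
  proof (rule sum.cong[OF refl])
    fix x assume "x \<in> X"
    then have "{v \<in> V. v \<in> f x} = f x" using assms(3) by auto
    then show "(\<Sum>v\<in>V. if v \<in> f x then 1 else 0) = card (f x)"
      using assms(2) by (simp flip: sum.inter_filter)
  qed
  finally show ?thesis .
qed

text \<open>The only component is the whole graph.\<close>
lemma connected_num_bipartite:
  assumes "simple_graph V E" "connected_graph V E"
  shows "num_bipartite_components V E = (if bipartite_graph V E then 1 else 0)"
proof -
  have V: "V \<noteq> {}" "\<And>u v. u \<in> V \<Longrightarrow> v \<in> V \<Longrightarrow> (u, v) \<in> joined V E"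
    using assms(2) by (auto simp: connected_graph_def)
  have "joined V E `` {v} = V" if "v \<in> V" for v using V(2)[OF that] by (auto simp: joined_def)
  then have "components V E = {V}" using V(1) by (auto simp: components_def quotient_def)
  moreover have "induced_edges E V = E" using assms(1) by (auto simp: simple_graph_def induced_edges_def)
  ultimately have "{C \<in> components V E. bipartite_graph C (induced_edges E C)} = (if bipartite_graph V E then {V} else {})"
    by auto
  then show ?thesis by (simp add: num_bipartite_components_def)
qed

lemma min_generators_attained:
  assumes "min_generators R J = enat n"
  obtains S where "finite S" "S \<subseteq> carrier R" "genideal R S = J" "card S = n"
proof -
  let ?A = "{enat (card S) | S. finite S \<and> S \<subseteq> carrier R \<and> genideal R S = J}"
  have "Inf ?A = enat n" using assms by (simp add: min_generators_def)
  moreover from this have "?A \<noteq> {}" by (metis Inf_enat_def enat.distinct(1))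
  ultimately have "enat n \<in> ?A" unfolding Inf_enat_def by (metis (mono_tags, lifting) LeastI equals0I)
  then show ?thesis using that by auto
qed

theorem theorem3p6:
  fixes V :: "'v set" and E :: "'v set set" and k :: "'k::field itself"
  assumes "simple_graph V E"
    and "connected_graph V E"
    and "complete_intersection k V E"
  shows "let S = (\<Sum>v\<in>V. int (num_bipartite_components (V - {v}) (induced_edges E (V - {v})))) in
         (bipartite_graph V E \<longrightarrow>
            2 * int (card E) + 4 \<le> 4 * int (card V) - S \<and>
            (2 * int (card E) + 4 = 4 * int (card V) - S \<longleftrightarrow>
               toric_generated_by_quadrics k V E)) \<and>
         (\<not> bipartite_graph V E \<longrightarrow>
            2 * int (card E) \<le> 3 * int (card V) - S \<and>
            (2 * int (card E) = 3 * int (card V) - S \<longleftrightarrow>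
               toric_generated_by_quadrics k V E))"
proof -
  let ?T = "toric_ideal V E :: ('v set, 'k) mpoly set"
  define S where "S = (\<Sum>v\<in>V. int (num_bipartite_components (V - {v}) (induced_edges E (V - {v}))))"
  define b where "b = num_bipartite_components V E"
  obtain h where h: "ideal_height (poly_ring E) ?T = enat h" "h + card V \<le> card E + b"
    using toric_height_le[OF assms(1)] unfolding b_def by metis
  have "min_generators (poly_ring E) ?T = enat h"
    using assms(3) h(1) by (simp add: complete_intersection_def)
  then obtain G where G: "finite G" "G \<subseteq> carrier (poly_ring E)" "genideal (poly_ring E) G = ?T" "card G = h"
    by (rule min_generators_attained)
  obtain I where "toric_binomials V E I ?T" by (rule toric_binomials_exist[OF assms(1) G(1-3)])
  then interpret toric_binomials V E I ?T .
  define D where "D i = Poly_Mapping.keys (deg (fst i))" for i :: "('v set \<Rightarrow>\<^sub>0 nat) \<times> ('v set \<Rightarrow>\<^sub>0 nat)"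
  have "card I \<le> h" using card_le_generators[OF G(1-3)] G(4) by simp
  then have few: "card I + card V \<le> card E + num_bipartite_components V E" using h(2) by (simp add: b_def)
  have cardI: "card I + card V = card E + b"
    using card_supported[OF few subset_refl] by (simp add: supported_V induced_V b_def)
  have DV: "D i \<subseteq> V" if "i \<in> I" for i
    using that supported_V by (auto simp: D_def supported_def)
  have deletion: "int (card {i \<in> I. v \<in> D i})
      = int b - 1 + int (card {e \<in> E. v \<in> e}) - int (num_bipartite_components (V - {v}) (induced_edges E (V - {v})))"
    if v: "v \<in> V" for v
  proof -
    let ?W = "V - {v}"
    have "card (supported ?W) + card ?W = card (induced_edges E ?W) + num_bipartite_components ?W (induced_edges E ?W)"
      using few by (rule card_supported) auto
    moreover have "int (card ?W) = int (card V) - 1"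
      using v card_Suc_Diff1[OF finite_V v] by linarith
    moreover have "int (card (supported ?W)) = int (card I) - int (card {i \<in> I. v \<in> D i})"
    proof -
      have "supported ?W = I - {i \<in> I. v \<in> D i}" using DV by (auto simp: supported_def D_def)
      moreover have "card {i \<in> I. v \<in> D i} \<le> card I" using finite_I by (intro card_mono) auto
      ultimately show ?thesis using finite_I by (simp add: card_Diff_subset of_nat_diff)
    qed
    moreover have "int (card (induced_edges E ?W)) = int (card E) - int (card {e \<in> E. v \<in> e})"
    proof -
      have "induced_edges E ?W = E - {e \<in> E. v \<in> e}" using edge_subset by (auto simp: induced_edges_def)
      moreover have "card {e \<in> E. v \<in> e} \<le> card E" using finite_E by (intro card_mono) auto
      ultimately show ?thesis using finite_E by (simp add: card_Diff_subset of_nat_diff)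
    qed
    ultimately show ?thesis using cardI by linarith
  qed
  have "(\<Sum>v\<in>V. card {e \<in> E. v \<in> e}) = (\<Sum>e\<in>E. card e)"
    using finite_E finite_V edge_subset by (rule sum_card_containing)
  also have "\<dots> = 2 * card E" using edge_card by simp
  finally have degrees: "(\<Sum>v\<in>V. int (card {e \<in> E. v \<in> e})) = 2 * int (card E)"
    by (simp flip: of_nat_sum)
  have "(\<Sum>i\<in>I. int (card (D i))) = (\<Sum>v\<in>V. int (card {i \<in> I. v \<in> D i}))"
    using sum_card_containing[OF finite_I finite_V DV] by (simp flip: of_nat_sum)
  also have "\<dots> = (\<Sum>v\<in>V. int b - 1 + int (card {e \<in> E. v \<in> e}) - int (num_bipartite_components (V - {v}) (induced_edges E (V - {v}))))"
    using deletion by (intro sum.cong) auto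
  also have "\<dots> = int (card V) * (int b - 1) + 2 * int (card E) - S"
    by (simp add: sum_subtractf sum.distrib degrees S_def)
  finally have total: "(\<Sum>i\<in>I. int (card (D i))) = int (card V) * (int b - 1) + 2 * int (card E) - S" .
  \<comment> \<open>The difference of the two sides of the claimed inequality is the total excess of the supports over
    four vertices.\<close>
  have ge4: "4 \<le> card (D i)" if "i \<in> I" for i
    using support_ge_4[of "fst i" "snd i"] that by (simp add: D_def)
  have excess: "(\<Sum>i\<in>I. int (card (D i)) - 4) = (\<Sum>i\<in>I. int (card (D i))) - 4 * int (card I)"
    by (simp add: sum_subtractf)
  have nonneg: "0 \<le> (\<Sum>i\<in>I. int (card (D i)) - 4)"
    using ge4 by (intro sum_nonneg) force
  have "(\<Sum>i\<in>I. int (card (D i)) - 4) = 0 \<longleftrightarrow> (\<forall>i\<in>I. int (card (D i)) - 4 = 0)"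
    using finite_I ge4 by (intro sum_nonneg_eq_0_iff) force+
  also have "\<dots> \<longleftrightarrow> toric_generated_by_quadrics k V E"
    unfolding toric_generated_by_quadrics_def quadrics_iff by (auto simp: D_def)
  finally have eq: "(\<Sum>i\<in>I. int (card (D i)) - 4) = 0 \<longleftrightarrow> toric_generated_by_quadrics k V E" .
  have b: "b = (if bipartite_graph V E then 1 else 0)"
    unfolding b_def by (rule connected_num_bipartite[OF assms(1,2)])
  have cardI': "int (card I) = int (card E) + int b - int (card V)" using cardI by linarith
  show ?thesis
    unfolding Let_def S_def[symmetric]
  proof (intro conjI impI)
    assume "bipartite_graph V E"
    then have X: "(\<Sum>i\<in>I. int (card (D i)) - 4) = 4 * int (card V) - S - (2 * int (card E) + 4)"
      using excess total cardI' b by simp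
    show "2 * int (card E) + 4 \<le> 4 * int (card V) - S" using X nonneg by linarith
    show "2 * int (card E) + 4 = 4 * int (card V) - S \<longleftrightarrow> toric_generated_by_quadrics k V E"
      unfolding eq[symmetric] X by linarith
  next
    assume "\<not> bipartite_graph V E"
    then have X: "(\<Sum>i\<in>I. int (card (D i)) - 4) = 3 * int (card V) - S - 2 * int (card E)"
      using excess total cardI' b by simp
    show "2 * int (card E) \<le> 3 * int (card V) - S" using X nonneg by linarith
    show "2 * int (card E) = 3 * int (card V) - S \<longleftrightarrow> toric_generated_by_quadrics k V E"
      unfolding eq[symmetric] X by linarith
  qed
qed

end
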